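(* Let $D$ be a domain in $\mathbb R^n$, $n\ge2$, $M\in[0,\infty)$, $x_0\in D$, and let $\varphi:[0,\infty]\to[0,\infty]$ be a nonconstant continuous (in the topology of $[0,\infty]$) nondecreasing convex function such that for some $t_*\in(t_0,\infty)$ and some $\alpha\in(0,1/(n-1))$ $$\int_{t_*}^{\infty}\Big(\frac{t}{\varphi(t)}\Big)^{\alpha}dt<\infty,$$ where $t_0=\sup\{t:\varphi(t)=0\}$ ($t_0=0$ if $\varphi>0$ everywhere). Let $\mathfrak F^{\varphi}_M$ be the family of all continuous mappings $f:D\to\mathbb R^m$ ($m\ge1$ fixed) of class $W^{1,1}_{\rm loc}(D)$ with $f(x_0)=0$ and $\int_D\varphi(|\nabla f(x)|)\,dm(x)\le M$. Then $\mathfrak F^{\varphi}_M$ is compact with respect to locally uniform convergence, i.e. every sequence in $\mathfrak F^{\varphi}_M$ has a subsequence converging uniformly on compact subsets of $D$, and every locally uniform limit of mappings in $\mathfrak F^{\varphi}_M$ belongs to $\mathfrak F^{\varphi}_M$.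
   Context: $m$ denotes Lebesgue measure on $\mathbb R^n$. For $f=(f_1,\dots,f_m)$ with $f_i\in W^{1,1}_{\rm loc}$, $|\nabla f(x)|=\big(\sum_{i,j}(\partial f_i/\partial x_j)^2\big)^{1/2}$. *)

theory Defs
  imports "HOL-Analysis.Analysis"
begin

fun Ck_fun :: "nat \<Rightarrow> (real^'n \<Rightarrow> real) set" where
  "Ck_fun 0 = {f. continuous_on UNIV f}"
| "Ck_fun (Suc k) = {f. \<exists>f'. (\<forall>x. (f has_derivative f' x) (at x)) \<and>
                         (\<forall>v. (\<lambda>x. f' x v) \<in> Ck_fun k)}"

definition smooth_fun :: "(real^'n \<Rightarrow> real) \<Rightarrow> bool" where
  "smooth_fun \<psi> \<longleftrightarrow> (\<forall>k. \<psi> \<in> Ck_fun k)"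

definition test_fun :: "(real^'n) set \<Rightarrow> (real^'n \<Rightarrow> real) \<Rightarrow> bool" where
  "test_fun D \<psi> \<longleftrightarrow> smooth_fun \<psi> \<and> compact (closure {x. \<psi> x \<noteq> 0})
                      \<and> closure {x. \<psi> x \<noteq> 0} \<subseteq> D"

definition locally_integrable :: "(real^'n) set \<Rightarrow> (real^'n \<Rightarrow> real) \<Rightarrow> bool" where
  "locally_integrable D u \<longleftrightarrow> (\<forall>K. compact K \<and> K \<subseteq> D \<longrightarrow> set_integrable lebesgue K u)"

definition weak_partial :: "(real^'n) set \<Rightarrow> 'n \<Rightarrow> (real^'n \<Rightarrow> real) \<Rightarrow> (real^'n \<Rightarrow> real) \<Rightarrow> bool" where
  "weak_partial D j u g \<longleftrightarrow> locally_integrable D u \<and> locally_integrable D g \<and>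
     (\<forall>\<psi>. test_fun D \<psi> \<longrightarrow>
        (LINT x:D|lebesgue. u x * frechet_derivative \<psi> (at x) (axis j 1))
        = - (LINT x:D|lebesgue. g x * \<psi> x))"

definition weak_jacobian :: "(real^'n) set \<Rightarrow> (real^'n \<Rightarrow> real^'m) \<Rightarrow> ('m \<Rightarrow> 'n \<Rightarrow> real^'n \<Rightarrow> real) \<Rightarrow> bool" where
  "weak_jacobian D f g \<longleftrightarrow> (\<forall>i j. weak_partial D j (\<lambda>x. f x $ i) (g i j))"

definition W11_loc :: "(real^'n) set \<Rightarrow> (real^'n \<Rightarrow> real^'m) \<Rightarrow> bool" where
  "W11_loc D f \<longleftrightarrow> (\<exists>g. weak_jacobian D f g)"

definition grad_norm :: "('m::finite \<Rightarrow> 'n::finite \<Rightarrow> real^'n \<Rightarrow> real) \<Rightarrow> real^'n \<Rightarrow> real" where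
  "grad_norm g x = sqrt (\<Sum>i\<in>UNIV. \<Sum>j\<in>UNIV. (g i j x)\<^sup>2)"

(* convexity of a function [0,\<infinity>] \<rightarrow> [0,\<infinity>], with extended arithmetic (0 * \<infinity> = 0) *)
definition ennreal_convex :: "(ennreal \<Rightarrow> ennreal) \<Rightarrow> bool" where
  "ennreal_convex \<phi> \<longleftrightarrow> (\<forall>s t (l::real). 0 \<le> l \<and> l \<le> 1 \<longrightarrow>
      \<phi> (ennreal l * s + ennreal (1 - l) * t) \<le> ennreal l * \<phi> s + ennreal (1 - l) * \<phi> t)"

definition family_F :: "(ennreal \<Rightarrow> ennreal) \<Rightarrow> real \<Rightarrow> (real^'n) set \<Rightarrow> real^'n \<Rightarrow> (real^'n \<Rightarrow> real^'m) set" where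
  "family_F \<phi> M D x0 = {f. continuous_on D f \<and> W11_loc D f \<and> f x0 = 0 \<and>
     (\<exists>g. weak_jacobian D f g \<and>
          (\<integral>\<^sup>+ x\<in>D. \<phi> (ennreal (grad_norm g x)) \<partial>lebesgue) \<le> ennreal M)}"

end

theory Submission
  imports Defs "HOL-Complex_Analysis.Great_Picard"
begin

text \<open>The integral condition together with monotonicity of $\varphi$ forces
  $\varphi(t) \ge c\,t^p$ for large $t$, where $p = 1 + 1/\alpha > n$. Hence members of the family
  have gradients bounded in $L^p$ on bounded sets, and a Morrey type estimate makes the family equicontinuous at
  every point of $D$; with $f(x_0) = 0$ and $D$ connected, Arzela--Ascoli applies. The estimate is
  obtained without mollification: the average of $u$ against the rescaled kernel
  $s^{-n}\beta((z-a)/s)$ has an $s$-derivative that is an integral of the weak gradient of $u$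
  against a test function, of size $O(s^{-n/p})$, and $n/p < 1$.

  For closedness, weak compactness is replaced by minimization. The gradients of those maps of finite energy
  that approximate the limit on larger and larger compact sets form decreasing midpoint-convex
  sets, bounded in a weighted $L^2$ because $p > 2$; almost minimizers converge strongly, and
  Fatou's lemma bounds the energy of the limit.\<close>

section \<open>A smooth bump function\<close>

text \<open>The upper bound on \<alpha> enters as 1/\<alpha> > n - 1, that is p > n, which is what
  makes s^(-n/p) integrable near s = 0. The growth estimate holds up to an additive constant and D
  may have infinite volume, so gradients are controlled in L^p on cubes but not on all of D;
  closedness therefore works with a weight of finite total mass. The obstacle in closedness is that
  weak convergence of gradients does not pass through the nonlinear \<phi>, whereas Fatou's lemma
  asks for convergence almost everywhere. What is minimized is the weighted square norm, not the
  energy: the parallelogram law gives it the uniform convexity that the \<phi>-energy may lack. The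
  limit matters as a weak gradient of the given limit map, not as a minimizer. Competing maps only
  need such a gradient and closeness to the limit map; continuity and the value at x0 come from
  locally uniform convergence of the original sequence.\<close>

lemma Ck_fun_SucI:
  "(\<And>x. (f has_derivative f' x) (at x)) \<Longrightarrow> (\<And>v. (\<lambda>x. f' x v) \<in> Ck_fun k) \<Longrightarrow> f \<in> Ck_fun (Suc k)"
  by (subst Ck_fun.simps) blast

lemma Ck_fun_SucE:
  assumes "f \<in> Ck_fun (Suc k)"
  obtains f' where "\<And>x. (f has_derivative f' x) (at x)" "\<And>v. (\<lambda>x. f' x v) \<in> Ck_fun k"
  using assms by (subst (asm) Ck_fun.simps) blast

lemma Ck_fun_Suc_subset: "f \<in> Ck_fun (Suc k) \<Longrightarrow> f \<in> Ck_fun k"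
proof (induction k arbitrary: f)
  case 0
  then obtain f' where "\<And>x. (f has_derivative f' x) (at x)" "\<And>v. (\<lambda>x. f' x v) \<in> Ck_fun 0"
    by (metis Ck_fun_SucE)
  then have "continuous_on UNIV f"
    by (meson continuous_at_imp_continuous_on has_derivative_continuous)
  then show ?case by simp
next
  case (Suc k)
  then obtain f' where f': "\<And>x. (f has_derivative f' x) (at x)" "\<And>v. (\<lambda>x. f' x v) \<in> Ck_fun (Suc k)"
    by (metis Ck_fun_SucE)
  show ?case
    by (rule Ck_fun_SucI[OF f'(1) Suc.IH[OF f'(2)]])
qed

lemma Ck_fun_const: "(\<lambda>x. c) \<in> Ck_fun k"
proof (induction k arbitrary: c)
  case (Suc k)
  show ?case by (rule Ck_fun_SucI[of _ "\<lambda>x h. 0"]) (auto intro: Suc.IH)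
qed auto

lemma Ck_fun_add: "\<lbrakk>f \<in> Ck_fun k; g \<in> Ck_fun k\<rbrakk> \<Longrightarrow> (\<lambda>x. f x + g x) \<in> Ck_fun k"
proof (induction k arbitrary: f g)
  case (Suc k)
  obtain f' where f: "\<And>x. (f has_derivative f' x) (at x)" "\<And>v. (\<lambda>x. f' x v) \<in> Ck_fun k"
    using Ck_fun_SucE[OF Suc.prems(1)] by metis
  obtain g' where g: "\<And>x. (g has_derivative g' x) (at x)" "\<And>v. (\<lambda>x. g' x v) \<in> Ck_fun k"
    using Ck_fun_SucE[OF Suc.prems(2)] by metis
  show ?case
    by (rule Ck_fun_SucI[OF has_derivative_add[OF f(1) g(1)] Suc.IH[OF f(2) g(2)]])
qed (simp add: continuous_on_add)

lemma Ck_fun_mult: "\<lbrakk>f \<in> Ck_fun k; g \<in> Ck_fun k\<rbrakk> \<Longrightarrow> (\<lambda>x. f x * g x) \<in> Ck_fun k"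
proof (induction k arbitrary: f g)
  case (Suc k)
  obtain f' where f: "\<And>x. (f has_derivative f' x) (at x)" "\<And>v. (\<lambda>x. f' x v) \<in> Ck_fun k"
    using Ck_fun_SucE[OF Suc.prems(1)] by metis
  obtain g' where g: "\<And>x. (g has_derivative g' x) (at x)" "\<And>v. (\<lambda>x. g' x v) \<in> Ck_fun k"
    using Ck_fun_SucE[OF Suc.prems(2)] by metis
  have "f \<in> Ck_fun k" "g \<in> Ck_fun k"
    using Suc.prems Ck_fun_Suc_subset by blast+
  then have "(\<lambda>x. f x * g' x v + f' x v * g x) \<in> Ck_fun k" for v
    by (intro Ck_fun_add Suc.IH f g)
  then show ?case
    by (rule Ck_fun_SucI[OF has_derivative_mult[OF f(1) g(1)]])
qed (simp add: continuous_on_mult)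

lemma Ck_fun_prod:
  "finite I \<Longrightarrow> (\<And>i. i \<in> I \<Longrightarrow> f i \<in> Ck_fun k) \<Longrightarrow> (\<lambda>x. \<Prod>i\<in>I. f i x) \<in> Ck_fun k"
proof (induction I rule: finite_induct)
  case empty
  show ?case by (simp add: Ck_fun_const)
next
  case (insert i I)
  then have "(\<lambda>x. f i x * (\<Prod>i\<in>I. f i x)) \<in> Ck_fun k"
    by (intro Ck_fun_mult) simp_all
  then show ?case using insert.hyps by simp
qed

lemma Ck_fun_nth: "(\<lambda>x::real^'n. x $ j) \<in> Ck_fun k"
proof (cases k)
  case 0
  then show ?thesis by (simp add: continuous_on_component)
next
  case (Suc l)
  have "((\<lambda>x. x $ j) has_derivative (\<lambda>h. h $ j)) (at x)" for x :: "real^'n"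
    by (rule bounded_linear_imp_has_derivative[OF bounded_linear_vec_nth])
  then show ?thesis
    unfolding Suc by (rule Ck_fun_SucI) (rule Ck_fun_const)
qed

lemma Ck_fun_affine: "f \<in> Ck_fun k \<Longrightarrow> (\<lambda>x. f (c *\<^sub>R x + b)) \<in> Ck_fun k"
proof (induction k arbitrary: f)
  case 0
  then have "continuous_on UNIV f" by simp
  then have "continuous_on UNIV (\<lambda>x. f (c *\<^sub>R x + b))"
    by (rule continuous_on_compose2) (auto intro!: continuous_intros)
  then show ?case by simp
next
  case (Suc k)
  obtain f' where f: "\<And>x. (f has_derivative f' x) (at x)" "\<And>v. (\<lambda>x. f' x v) \<in> Ck_fun k"
    using Ck_fun_SucE[OF Suc.prems] by metis
  have "((\<lambda>x. f (c *\<^sub>R x + b)) has_derivative (\<lambda>h. f' (c *\<^sub>R x + b) (c *\<^sub>R h))) (at x)" for x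
    by (rule has_derivative_compose[of "\<lambda>x. c *\<^sub>R x + b", OF _ f(1)]) (auto intro!: derivative_eq_intros)
  then show ?case
    by (rule Ck_fun_SucI[OF _ Suc.IH[OF f(2)]])
qed

text \<open>The polynomial in 1/t is carried along because differentiation stays inside this family
  and only changes the polynomial. Smoothness then follows by one induction over all polynomials at
  once.\<close>

definition flat :: "real poly \<Rightarrow> real \<Rightarrow> real" where
  "flat p t = (if t > 0 then poly p (1 / t) * exp (- (1 / t)) else 0)"

lemma tendsto_poly_div_exp_0: "((\<lambda>x. poly p x / exp x) \<longlongrightarrow> (0::real)) at_top"
proof -
  have "((\<lambda>x. \<Sum>i\<le>degree p. coeff p i * (x ^ i / exp x)) \<longlongrightarrow> (\<Sum>i\<le>degree p. coeff p i * 0)) at_top"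
    by (intro tendsto_intros tendsto_power_div_exp_0)
  then show ?thesis
    by (simp add: poly_altdef sum_divide_distrib)
qed

lemma flat_tendsto_0: "(flat p \<longlongrightarrow> 0) (at 0)"
proof -
  have "((\<lambda>t. poly p (inverse t) / exp (inverse t)) \<longlongrightarrow> 0) (at_right 0)"
    by (rule filterlim_compose[OF tendsto_poly_div_exp_0 filterlim_inverse_at_top_right])
  then have "(flat p \<longlongrightarrow> 0) (at_right 0)"
    by (rule Lim_transform_eventually)
       (auto simp: flat_def eventually_at_filter exp_minus divide_simps)
  moreover have "(flat p \<longlongrightarrow> 0) (at_left 0)"
    by (rule tendsto_eventually) (auto simp: flat_def eventually_at_filter)
  ultimately show ?thesis
    by (simp add: filterlim_split_at)
qed

text \<open>For t > 0 the chain rule gives (p - p')(1/t) * (1/t)^2 * exp(-1/t), and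
  \<open>[:0,0,1:]\<close> is the polynomial that supplies the factor (1/t)^2.\<close>

lemma flat_has_derivative: "(flat p has_real_derivative flat ([:0,0,1:] * (p - pderiv p)) t) (at t)"
proof -
  consider "t > 0" | "t < 0" | "t = 0" by linarith
  then show ?thesis
  proof cases
    case 1
    have "((\<lambda>t. 1 / t) has_real_derivative - (1 / t\<^sup>2)) (at t)"
      using 1 by (auto intro!: derivative_eq_intros simp: power2_eq_square)
    then have "((\<lambda>t. poly p (1 / t) * exp (- (1 / t))) has_real_derivative
          poly (pderiv p) (1 / t) * - (1 / t\<^sup>2) * exp (- (1 / t))
            + exp (- (1 / t)) * - (- (1 / t\<^sup>2)) * poly p (1 / t)) (at t)"
      by (intro DERIV_mult DERIV_chain2[OF poly_DERIV] DERIV_chain2[OF DERIV_exp] DERIV_minus)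
    moreover have "poly (pderiv p) (1 / t) * - (1 / t\<^sup>2) * exp (- (1 / t))
        + exp (- (1 / t)) * - (- (1 / t\<^sup>2)) * poly p (1 / t) = flat ([:0,0,1:] * (p - pderiv p)) t"
      using 1 by (simp add: flat_def field_simps power2_eq_square)
    ultimately have "((\<lambda>t. poly p (1 / t) * exp (- (1 / t))) has_real_derivative
        flat ([:0,0,1:] * (p - pderiv p)) t) (at t)" by simp
    then show ?thesis
      by (rule has_field_derivative_transform_within_open[of _ _ _ "{0<..}"]) (use 1 in \<open>auto simp: flat_def\<close>)
  next
    case 2
    have "((\<lambda>t. 0) has_real_derivative 0) (at t)" by simp
    then have "(flat p has_real_derivative 0) (at t)"
      by (rule has_field_derivative_transform_within_open[of _ _ _ "{..<0}"]) (use 2 in \<open>auto simp: flat_def\<close>)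
    then show ?thesis
      using 2 by (simp add: flat_def)
  next
    case 3
    \<comment> \<open>The difference quotient at 0 is again a flat function, with X * p in place of
      p, so its limit is already known.\<close>
    have "((\<lambda>h. flat p h / h) \<longlongrightarrow> 0) (at 0)"
      by (rule Lim_transform_eventually[OF flat_tendsto_0[of "[:0,1:] * p"]])
         (auto simp: flat_def eventually_at_filter)
    then show ?thesis
      using 3 by (simp add: DERIV_def flat_def)
  qed
qed

lemma Ck_fun_flat: "(\<lambda>x::real^'n. flat p (c + d * x $ j)) \<in> Ck_fun k"
proof (induction k arbitrary: p)
  case 0
  have "continuous_on UNIV (flat p)"
    using flat_has_derivative DERIV_isCont continuous_at_imp_continuous_on by blast
  then have "continuous_on UNIV (\<lambda>x::real^'n. flat p (c + d * x $ j))"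
    by (rule continuous_on_compose2) (auto intro!: continuous_intros)
  then show ?case by simp
next
  case (Suc k)
  let ?q = "[:0,0,1:] * (p - pderiv p)"
  have d: "((\<lambda>x. flat p (c + d * x $ j)) has_derivative (\<lambda>h. flat ?q (c + d * x $ j) * (d * h $ j))) (at x)"
    for x :: "real^'n"
  proof -
    have "((\<lambda>x. x $ j) has_derivative (\<lambda>h. h $ j)) (at x)"
      by (rule bounded_linear_imp_has_derivative[OF bounded_linear_vec_nth])
    then have "((\<lambda>x. c + d * x $ j) has_derivative (\<lambda>h. 0 + d * h $ j)) (at x)"
      by (intro has_derivative_add has_derivative_const has_derivative_mult_right)
    moreover have "(flat p has_derivative (*) (flat ?q (c + d * x $ j))) (at (c + d * x $ j))"
      using flat_has_derivative unfolding has_field_derivative_def .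
    ultimately show ?thesis
      using has_derivative_compose by fastforce
  qed
  show ?case
    by (rule Ck_fun_SucI, rule d, intro Ck_fun_mult Suc.IH Ck_fun_const)
qed

text \<open>A product over coordinates instead of a radial profile: smoothness reduces to functions
  of one variable, and the support is a cube. No normalization is made; the integral of
  \<open>bump\<close> is carried as a factor in the estimates.\<close>

definition bump :: "real^'n \<Rightarrow> real" where
  "bump x = (\<Prod>j\<in>UNIV. flat 1 (1 + x $ j) * flat 1 (1 - x $ j))"

lemma smooth_bump: "smooth_fun bump"
proof -
  have "(\<lambda>x::real^'n. \<Prod>j\<in>UNIV. flat 1 (1 + 1 * x $ j) * flat 1 (1 + (-1) * x $ j)) \<in> Ck_fun k" for k
    by (intro Ck_fun_prod Ck_fun_mult Ck_fun_flat) auto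
  then show ?thesis
    by (auto simp: smooth_fun_def bump_def[abs_def])
qed

lemma bump_bounds: "0 \<le> bump x" "bump x \<le> 1"
proof -
  have "0 \<le> flat 1 t" "flat 1 t \<le> 1" for t by (auto simp: flat_def)
  then show "0 \<le> bump x" "bump x \<le> 1"
    by (auto simp: bump_def intro!: prod_nonneg prod_le_1 mult_le_one)
qed

lemma bump_eq_0: "\<bar>x $ j\<bar> \<ge> 1 \<Longrightarrow> bump x = 0"
  unfolding bump_def by (rule prod_zero) (auto simp: flat_def abs_if split: if_splits intro!: exI[of _ j])

lemma bump_0_pos: "bump 0 > 0"
  by (auto simp: bump_def flat_def intro!: prod_pos)

lemma smooth_fun_mult: "smooth_fun f \<Longrightarrow> smooth_fun g \<Longrightarrow> smooth_fun (\<lambda>x. f x * g x)"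
  by (simp add: smooth_fun_def Ck_fun_mult)

lemma smooth_fun_affine: "smooth_fun f \<Longrightarrow> smooth_fun (\<lambda>x. f (c *\<^sub>R x + b))"
  by (simp add: smooth_fun_def Ck_fun_affine)

lemma smooth_fun_nth_diff: "smooth_fun (\<lambda>x::real^'n. x $ j - c)"
proof -
  have "(\<lambda>x::real^'n. x $ j + - c) \<in> Ck_fun k" for k
    by (intro Ck_fun_add Ck_fun_nth Ck_fun_const)
  then show ?thesis by (auto simp: smooth_fun_def)
qed

section \<open>Oscillation estimate of Morrey type\<close>

lemma smooth_fun_has_derivative:
  assumes "smooth_fun \<psi>"
  shows "(\<psi> has_derivative frechet_derivative \<psi> (at x)) (at x)"
    and "continuous_on UNIV (\<lambda>x. frechet_derivative \<psi> (at x) v)"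
proof -
  have "\<psi> \<in> Ck_fun (Suc 0)" using assms unfolding smooth_fun_def by blast
  then obtain f' where f': "\<And>x. (\<psi> has_derivative f' x) (at x)" "\<And>v. (\<lambda>x. f' x v) \<in> Ck_fun 0"
    by (metis Ck_fun_SucE)
  have eq: "f' x = frechet_derivative \<psi> (at x)" for x
    using f'(1) by (rule frechet_derivative_at)
  show "(\<psi> has_derivative frechet_derivative \<psi> (at x)) (at x)"
    using f'(1) eq by metis
  show "continuous_on UNIV (\<lambda>x. frechet_derivative \<psi> (at x) v)"
    using f'(2)[of v] by (simp add: eq)
qed

lemma smooth_fun_continuous: "smooth_fun \<psi> \<Longrightarrow> continuous_on UNIV \<psi>"
  by (meson continuous_at_imp_continuous_on has_derivative_continuous smooth_fun_has_derivative(1))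

lemma frechet_derivative_outside_support:
  assumes "x \<notin> closure {x. \<psi> x \<noteq> 0}"
  shows "frechet_derivative \<psi> (at x) v = 0"
proof -
  have "(\<psi> has_derivative (\<lambda>h. 0)) (at x)"
  proof (rule has_derivative_transform_within_open[of "\<lambda>x. 0" _ _ _ "- closure {x. \<psi> x \<noteq> 0}"])
    show "0 = \<psi> y" if "y \<in> - closure {x. \<psi> x \<noteq> 0}" for y
      using that closure_subset[of "{x. \<psi> x \<noteq> 0}"] by auto
  qed (use assms in auto)
  then show ?thesis using frechet_derivative_at by metis
qed

text \<open>The weak derivative identity integrates over D, while local integrability speaks of
  compact subsets only. A factor that vanishes off K lets one pass between the two.\<close>

lemma integrable_mult_compact_support:
  fixes u :: "'a::euclidean_space \<Rightarrow> real"
  assumes u: "set_integrable lebesgue K u" and K: "compact K" "K \<subseteq> D"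
    and \<psi>: "continuous_on UNIV \<psi>" "\<And>x. x \<notin> K \<Longrightarrow> \<psi> x = 0"
  shows "set_integrable lebesgue D (\<lambda>x. u x * \<psi> x)"
    and "(LINT x:D|lebesgue. u x * \<psi> x) = (LINT x:K|lebesgue. u x * \<psi> x)"
proof -
  have eq: "indicator D x *\<^sub>R (u x * \<psi> x) = indicator K x *\<^sub>R (u x * \<psi> x)" for x
    using K(2) \<psi>(2) by (auto simp: indicator_def)
  have "compact (\<psi> ` K)"
    using K(1) \<psi>(1) compact_continuous_image continuous_on_subset by blast
  then obtain B where B: "\<And>x. x \<in> K \<Longrightarrow> \<bar>\<psi> x\<bar> \<le> B"
    by (metis compact_imp_bounded bounded_iff image_eqI real_norm_def)
  have m: "\<psi> \<in> borel_measurable lebesgue"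
    using borel_measurable_continuous_onI[OF \<psi>(1)] by (simp add: measurable_completion)
  have "integrable lebesgue (\<lambda>x. indicator K x *\<^sub>R (u x * \<psi> x))"
  proof (rule Bochner_Integration.integrable_bound)
    show "integrable lebesgue (\<lambda>x. B * (indicator K x *\<^sub>R u x))"
      using u unfolding set_integrable_def by (rule integrable_mult_right)
    have "(\<lambda>x. indicator K x *\<^sub>R u x) \<in> borel_measurable lebesgue"
      using u unfolding set_integrable_def by auto
    with m have "(\<lambda>x. (indicator K x *\<^sub>R u x) * \<psi> x) \<in> borel_measurable lebesgue"
      by (intro borel_measurable_times)
    then show "(\<lambda>x. indicator K x *\<^sub>R (u x * \<psi> x)) \<in> borel_measurable lebesgue"
      by (simp add: mult.assoc)
    show "AE x in lebesgue. norm (indicator K x *\<^sub>R (u x * \<psi> x)) \<le> norm (B * (indicator K x *\<^sub>R u x))"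
    proof (intro AE_I2)
      fix x
      have "\<bar>u x\<bar> * \<bar>\<psi> x\<bar> \<le> \<bar>u x\<bar> * \<bar>B\<bar>" if "x \<in> K"
        using B[OF that] by (intro mult_left_mono) auto
      then show "norm (indicator K x *\<^sub>R (u x * \<psi> x)) \<le> norm (B * (indicator K x *\<^sub>R u x))"
        by (auto simp: indicator_def abs_mult mult.commute)
    qed
  qed
  then show "set_integrable lebesgue D (\<lambda>x. u x * \<psi> x)"
    by (simp only: set_integrable_def eq)
  show "(LINT x:D|lebesgue. u x * \<psi> x) = (LINT x:K|lebesgue. u x * \<psi> x)"
    by (simp only: set_lebesgue_integral_def eq)
qed

text \<open>The closed sup-norm ball. Being a \<open>cbox\<close>, it admits the Leibniz rule and
  affine substitution for integrals over boxes, and it matches the support of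
  \<open>bump\<close>.\<close>

definition cube :: "real^'n \<Rightarrow> real \<Rightarrow> (real^'n) set" where
  "cube a \<rho> = cbox (a - \<rho> *\<^sub>R 1) (a + \<rho> *\<^sub>R 1)"

lemma mem_cube: "z \<in> cube a \<rho> \<longleftrightarrow> (\<forall>j. \<bar>z $ j - a $ j\<bar> \<le> \<rho>)"
  by (auto simp: cube_def mem_box_cart abs_le_iff algebra_simps)

lemma cube_mono: "\<rho> \<le> \<rho>' \<Longrightarrow> cube a \<rho> \<subseteq> cube a \<rho>'"
  by (meson mem_cube order_trans subsetI)

lemma compact_cube: "compact (cube a \<rho>)"
  by (simp add: cube_def)

lemma emeasure_cube:
  assumes "0 \<le> \<rho>"
  shows "emeasure lebesgue (cube (a::real^'n) \<rho>) = ennreal ((2 * \<rho>) ^ CARD('n))"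
proof -
  have "cube a \<rho> \<noteq> {}" using assms mem_cube[of a a \<rho>] by auto
  then have "measure lebesgue (cube a \<rho>) = (2 * \<rho>) ^ CARD('n)"
    by (simp add: cube_def content_cbox_cart)
  moreover have "cube a \<rho> \<in> lmeasurable" by (simp add: cube_def)
  ultimately show ?thesis by (metis emeasure_eq_measure2)
qed

section \<open>Dilated kernels and the derivative of an average with respect to the scale\<close>

lemma linear_vec_sum:
  fixes L :: "real^'n \<Rightarrow> real"
  assumes "linear L"
  shows "L h = (\<Sum>j\<in>UNIV. h $ j * L (axis j 1))"
proof -
  have "L h = L (\<Sum>j\<in>UNIV. h $ j *\<^sub>R axis j 1)"
    using basis_expansion[of h] by (simp add: scalar_mult_eq_scaleR)
  also have "\<dots> = (\<Sum>j\<in>UNIV. h $ j * L (axis j 1))"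
    using assms by (simp add: linear_sum linear_cmul)
  finally show ?thesis .
qed

text \<open>The derivative of a dilated kernel is a divergence; this is what brings in the weak
  partial derivatives.\<close>

lemma dilation_partial:
  fixes \<beta> :: "real^'n \<Rightarrow> real"
  assumes \<beta>: "smooth_fun \<beta>" and s: "0 < s"
  shows "frechet_derivative (\<lambda>z. (z $ j - a $ j) * \<beta> ((z - a) /\<^sub>R s)) (at z) (axis j 1)
        = (z $ j - a $ j) / s * frechet_derivative \<beta> (at ((z - a) /\<^sub>R s)) (axis j 1) + \<beta> ((z - a) /\<^sub>R s)"
proof -
  define \<beta>' where "\<beta>' = frechet_derivative \<beta> (at ((z - a) /\<^sub>R s))"
  have \<beta>': "(\<beta> has_derivative \<beta>') (at ((z - a) /\<^sub>R s))"
    unfolding \<beta>'_def by (rule smooth_fun_has_derivative[OF \<beta>])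
  then have lin: "linear \<beta>'" by (rule has_derivative_linear)
  have "((\<lambda>z. (z - a) /\<^sub>R s) has_derivative (\<lambda>h. h /\<^sub>R s)) (at z)"
    by (auto intro!: derivative_eq_intros simp: scaleR_diff_right)
  from has_derivative_compose[OF this \<beta>']
  have 1: "((\<lambda>z. \<beta> ((z - a) /\<^sub>R s)) has_derivative (\<lambda>h. \<beta>' (h /\<^sub>R s))) (at z)" .
  have "((\<lambda>z. z $ j) has_derivative (\<lambda>h. h $ j)) (at z)"
    by (rule bounded_linear_imp_has_derivative[OF bounded_linear_vec_nth])
  then have 2: "((\<lambda>z. z $ j - a $ j) has_derivative (\<lambda>h. h $ j - 0)) (at z)"
    by (rule has_derivative_diff[OF _ has_derivative_const])
  have "((\<lambda>z. (z $ j - a $ j) * \<beta> ((z - a) /\<^sub>R s)) has_derivative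
     (\<lambda>h. (z $ j - a $ j) * \<beta>' (h /\<^sub>R s) + (h $ j - 0) * \<beta> ((z - a) /\<^sub>R s))) (at z)"
    by (rule has_derivative_mult[OF 2 1])
  from frechet_derivative_at[OF this, symmetric] show ?thesis
    using linear_cmul[OF lin, of "inverse s" "axis j 1"]
    by (simp add: \<beta>'_def[symmetric] divide_inverse)
qed

text \<open>Put w = (z - a)/s and n = \<open>CARD('n)\<close>. The chain rule yields -(D\<beta>(w) w
  + n \<beta>(w)) / s^(n+1). Summing \<open>dilation_partial\<close> over the n coordinates produces
  the same bracket, as the divergence of the field (z - a) \<beta>((z - a)/s).\<close>

lemma dilation_has_derivative:
  fixes \<beta> :: "real^'n \<Rightarrow> real"
  assumes \<beta>: "smooth_fun \<beta>" and s: "0 < s"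
  shows "((\<lambda>s. \<beta> ((z - a) /\<^sub>R s) / s ^ CARD('n)) has_vector_derivative
     - (\<Sum>j\<in>UNIV. frechet_derivative (\<lambda>z. (z $ j - a $ j) * \<beta> ((z - a) /\<^sub>R s)) (at z) (axis j 1)) / s ^ Suc CARD('n)) (at s)"
proof -
  define n where "n = CARD('n)"
  define w where "w = (z - a) /\<^sub>R s"
  define \<beta>' where "\<beta>' = frechet_derivative \<beta> (at w)"
  have \<beta>': "(\<beta> has_derivative \<beta>') (at w)"
    unfolding \<beta>'_def by (rule smooth_fun_has_derivative[OF \<beta>])
  then have lin: "linear \<beta>'" by (rule has_derivative_linear)
  have "((\<lambda>s. (1 / s) *\<^sub>R (z - a)) has_vector_derivative (- (1 / s)) *\<^sub>R w) (at s)"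
    unfolding w_def using s by (auto intro!: derivative_eq_intros simp: field_simps power2_eq_square)
  then have "((\<lambda>s. (z - a) /\<^sub>R s) has_vector_derivative (- (1 / s)) *\<^sub>R w) (at s)"
    by (simp add: divide_inverse)
  from vector_derivative_diff_chain_within[OF this, of \<beta> \<beta>'] \<beta>'
  have "((\<lambda>s. \<beta> ((z - a) /\<^sub>R s)) has_vector_derivative \<beta>' ((- (1 / s)) *\<^sub>R w)) (at s)"
    by (simp add: o_def w_def has_derivative_at_withinI)
  then have d1: "((\<lambda>s. \<beta> ((z - a) /\<^sub>R s)) has_real_derivative - (\<beta>' w / s)) (at s)"
    using linear_cmul[OF lin, of "- (1 / s)" w]
    by (simp add: has_real_derivative_iff_has_vector_derivative)
  have d2: "((\<lambda>s. s ^ n) has_real_derivative real n * s ^ (n - 1)) (at s)"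
    by (auto intro!: derivative_eq_intros)
  have "((\<lambda>s. \<beta> ((z - a) /\<^sub>R s) / s ^ n) has_real_derivative
     (- (\<beta>' w / s) * s ^ n - \<beta> w * (real n * s ^ (n - 1))) / (s ^ n * s ^ n)) (at s)"
    unfolding w_def using DERIV_divide[OF d1[unfolded w_def] d2] s by simp
  moreover have n: "s ^ n = s * s ^ (n - 1)"
    unfolding n_def by (metis One_nat_def Suc_pred power_Suc zero_less_card_finite)
  have "(- (\<beta>' w / s) * s ^ n - \<beta> w * (real n * s ^ (n - 1))) / (s ^ n * s ^ n)
      = - (\<beta>' w + real n * \<beta> w) / s ^ Suc n"
    using s by (simp add: n field_simps)
  ultimately have V: "((\<lambda>s. \<beta> ((z - a) /\<^sub>R s) / s ^ n) has_real_derivative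
      - (\<beta>' w + real n * \<beta> w) / s ^ Suc n) (at s)"
    by simp
  have "frechet_derivative (\<lambda>z. (z $ j - a $ j) * \<beta> ((z - a) /\<^sub>R s)) (at z) (axis j 1)
        = w $ j * \<beta>' (axis j 1) + \<beta> w" for j
    by (simp add: dilation_partial[OF \<beta> s] w_def \<beta>'_def divide_inverse mult.commute)
  then have "(\<Sum>j\<in>UNIV. frechet_derivative (\<lambda>z. (z $ j - a $ j) * \<beta> ((z - a) /\<^sub>R s)) (at z) (axis j 1))
      = \<beta>' w + real n * \<beta> w"
    by (simp add: sum.distrib n_def linear_vec_sum[OF lin, of w])
  with V show ?thesis
    by (simp add: n_def has_real_derivative_iff_has_vector_derivative)
qed


lemma test_fun_dilation:
  fixes \<beta> :: "real^'n \<Rightarrow> real"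
  assumes \<beta>: "smooth_fun \<beta>" "\<And>w. w \<notin> cube 0 2 \<Longrightarrow> \<beta> w = 0" and s: "0 < s"
    and D: "cube a (2 * s) \<subseteq> D"
  shows "test_fun D (\<lambda>z. (z $ j - a $ j) * \<beta> ((z - a) /\<^sub>R s))"
    and "z \<notin> cube a (2 * s) \<Longrightarrow> \<beta> ((z - a) /\<^sub>R s) = 0"
proof -
  let ?\<psi> = "\<lambda>z. (z $ j - a $ j) * \<beta> ((z - a) /\<^sub>R s)"
  have 0: "\<beta> ((z - a) /\<^sub>R s) = 0" if "z \<notin> cube a (2 * s)" for z
  proof (rule \<beta>(2))
    show "(z - a) /\<^sub>R s \<notin> cube 0 2"
      using that s by (auto simp: mem_cube abs_mult divide_simps abs_minus_commute)
  qed
  then show "z \<notin> cube a (2 * s) \<Longrightarrow> \<beta> ((z - a) /\<^sub>R s) = 0" .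
  have sub: "closure {z. ?\<psi> z \<noteq> 0} \<subseteq> cube a (2 * s)"
  proof (rule closure_minimal)
    show "{z. ?\<psi> z \<noteq> 0} \<subseteq> cube a (2 * s)" using 0 by auto
  qed (rule compact_imp_closed[OF compact_cube])
  have "compact (cube a (2 * s) \<inter> closure {z. ?\<psi> z \<noteq> 0})"
    by (intro compact_Int_closed compact_cube closed_closure)
  then have "compact (closure {z. ?\<psi> z \<noteq> 0})"
    using sub by (simp only: Int_absorb1)
  moreover have "smooth_fun (\<lambda>z. \<beta> ((1 / s) *\<^sub>R z + - (a /\<^sub>R s)))"
    by (rule smooth_fun_affine[OF \<beta>(1)])
  then have "smooth_fun (\<lambda>z. \<beta> ((z - a) /\<^sub>R s))"
    by (simp add: scaleR_diff_right inverse_eq_divide)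
  then have "smooth_fun ?\<psi>"
    by (rule smooth_fun_mult[OF smooth_fun_nth_diff])
  ultimately show "test_fun D ?\<psi>"
    using D sub unfolding test_fun_def by blast
qed

text \<open>For a > \<kappa> the ratio a/\<kappa> exceeds 1, so a factor (a/\<kappa>)^(p-1) only
  enlarges a. With \<kappa> free, this pointwise bound takes the place of Holder's inequality: the
  first term is integrated against the volume, the second yields the p-energy.\<close>

lemma young_powr:
  fixes a p \<kappa> :: real
  assumes "0 \<le> a" "0 < \<kappa>" "1 \<le> p"
  shows "a \<le> \<kappa> + \<kappa> powr (1 - p) * a powr p"
proof (cases "a \<le> \<kappa>")
  case False
  have "a = a * 1" by simp
  also have "\<dots> \<le> a * (a / \<kappa>) powr (p - 1)"
    using False assms by (intro mult_left_mono ge_one_powr_ge_zero) auto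
  also have "\<dots> = \<kappa> powr (1 - p) * a powr p"
    using False assms by (simp add: powr_divide powr_diff field_simps)
  finally show ?thesis using assms by simp
qed (use assms in \<open>simp add: add_increasing2\<close>)

definition local_energy :: "real^'n \<Rightarrow> real \<Rightarrow> real \<Rightarrow> (real^'n \<Rightarrow> real) \<Rightarrow> ennreal" where
  "local_energy a \<rho> p g = (\<integral>\<^sup>+z\<in>cube a \<rho>. ennreal (\<bar>g z\<bar> powr p) \<partial>lebesgue)"

text \<open>The kernel vanishes off the cube of radius 2s and is at most 2s in size there, so what
  remains is the integral of |g| over a cube of volume (4s)^n. The energy is taken over the fixed
  cube of radius 2r and enters linearly instead of through a p-th root; this is enough, since only a
  power of s uniform in g is wanted.\<close>

lemma weighted_integral_bound:
  fixes g :: "real^'n \<Rightarrow> real"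
  assumes \<beta>: "smooth_fun \<beta>" "\<And>w. w \<notin> cube 0 2 \<Longrightarrow> \<beta> w = 0" "\<And>w. \<bar>\<beta> w\<bar> \<le> 1"
    and s: "0 < s" "s \<le> r" and D: "cube a (2 * r) \<subseteq> D"
    and g: "locally_integrable D g"
    and p: "real CARD('n) < p"
    and E: "local_energy a (2 * r) p g \<le> ennreal E" "0 \<le> E"
  shows "\<bar>LINT z:D|lebesgue. g z * ((z $ j - a $ j) * \<beta> ((z - a) /\<^sub>R s))\<bar>
     \<le> 2 * (4 ^ CARD('n) + E) * s powr (1 + real CARD('n) - real CARD('n) / p)"
proof -
  define n where "n = real CARD('n)"
  \<comment> \<open>this threshold balances the two terms of Young's inequality after multiplication by $s^{-n}$\<close>
  define \<kappa> where "\<kappa> = s powr (- (n / p))"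
  have n: "0 < n" "n < p" using p by (auto simp: n_def)
  have "1 \<le> n" by (simp add: n_def Suc_leI)
  then have p1: "1 \<le> p" using n by linarith
  have \<kappa>: "0 < \<kappa>" using s by (simp add: \<kappa>_def)
  let ?Q = "cube a (2 * r)" and ?Qs = "cube a (2 * s)"
  let ?\<psi> = "\<lambda>z. (z $ j - a $ j) * \<beta> ((z - a) /\<^sub>R s)"
  have Qs: "?Qs \<subseteq> ?Q" using s by (intro cube_mono) auto
  then have QsD: "?Qs \<subseteq> D" using D by blast
  have gQ: "set_integrable lebesgue ?Q g" and gQs: "set_integrable lebesgue ?Qs g"
    using g D QsD compact_cube unfolding locally_integrable_def by blast+
  have tst: "test_fun D ?\<psi>"
    by (rule test_fun_dilation(1)[OF \<beta>(1) _ s(1) QsD]) (rule \<beta>(2))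
  have \<psi>0: "?\<psi> z = 0" if "z \<notin> ?Qs" for z
    using test_fun_dilation(2)[OF \<beta>(1) _ s(1) QsD that] \<beta>(2) by simp
  have cont: "continuous_on UNIV ?\<psi>"
    using tst smooth_fun_continuous unfolding test_fun_def by blast
  have int: "set_integrable lebesgue D (\<lambda>z. g z * ?\<psi> z)"
    by (rule integrable_mult_compact_support[OF gQs compact_cube QsD cont \<psi>0])
  let ?h = "\<lambda>z. indicator ?Q z *\<^sub>R g z"
  have hm: "?h \<in> borel_measurable lebesgue"
    using gQ unfolding set_integrable_def by auto
  then have hp: "(\<lambda>z. ennreal (\<bar>?h z\<bar> powr p)) \<in> borel_measurable lebesgue"
    by measurable
  have Qsm: "?Qs \<in> sets lebesgue" by (simp add: cube_def)
  have "ennreal \<bar>LINT z:D|lebesgue. g z * ?\<psi> z\<bar>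
      \<le> (\<integral>\<^sup>+z. ennreal (norm (indicator D z *\<^sub>R (g z * ?\<psi> z))) \<partial>lebesgue)"
    using integral_norm_bound_ennreal[OF int[unfolded set_integrable_def]]
    by (simp add: set_lebesgue_integral_def)
  also have "\<dots> \<le> (\<integral>\<^sup>+z. ennreal (2 * s) * (ennreal \<kappa> * indicator ?Qs z
      + ennreal (\<kappa> powr (1 - p)) * ennreal (\<bar>?h z\<bar> powr p)) \<partial>lebesgue)"
  proof (rule nn_integral_mono)
    fix z
    show "ennreal (norm (indicator D z *\<^sub>R (g z * ?\<psi> z))) \<le> ennreal (2 * s) * (ennreal \<kappa> * indicator ?Qs z
      + ennreal (\<kappa> powr (1 - p)) * ennreal (\<bar>?h z\<bar> powr p))"
    proof (cases "z \<in> ?Qs")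
      case True
      have "\<bar>g z\<bar> \<le> \<kappa> + \<kappa> powr (1 - p) * \<bar>g z\<bar> powr p"
        using \<kappa> p1 by (intro young_powr) auto
      moreover have "\<bar>?\<psi> z\<bar> \<le> 2 * s * 1"
        unfolding abs_mult using True \<beta>(3) s by (intro mult_mono) (auto simp: mem_cube)
      ultimately have "\<bar>g z\<bar> * \<bar>?\<psi> z\<bar> \<le> (\<kappa> + \<kappa> powr (1 - p) * \<bar>g z\<bar> powr p) * (2 * s)"
        by (intro mult_mono) auto
      then have "ennreal (norm (indicator D z *\<^sub>R (g z * ?\<psi> z)))
          \<le> ennreal (2 * s * (\<kappa> + \<kappa> powr (1 - p) * \<bar>g z\<bar> powr p))"
        using True QsD by (intro ennreal_leI) (auto simp: abs_mult mult.commute indicator_def)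
      also have "\<dots> = ennreal (2 * s) * (ennreal \<kappa> * indicator ?Qs z
      + ennreal (\<kappa> powr (1 - p)) * ennreal (\<bar>?h z\<bar> powr p))"
        using True Qs \<kappa> s by (auto simp: ennreal_mult indicator_def)
      finally show ?thesis .
    qed (use \<psi>0[of z] in auto)
  qed
  also have "\<dots> = ennreal (2 * s) * (ennreal \<kappa> * emeasure lebesgue ?Qs
      + ennreal (\<kappa> powr (1 - p)) * (\<integral>\<^sup>+z. ennreal (\<bar>?h z\<bar> powr p) \<partial>lebesgue))"
    using hp Qsm by (simp add: nn_integral_cmult nn_integral_add)
  also have "(\<integral>\<^sup>+z. ennreal (\<bar>?h z\<bar> powr p) \<partial>lebesgue) = local_energy a (2 * r) p g"
    unfolding local_energy_def using n by (intro nn_integral_cong) (auto simp: indicator_def)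
  also have "ennreal (2 * s) * (ennreal \<kappa> * emeasure lebesgue ?Qs
      + ennreal (\<kappa> powr (1 - p)) * local_energy a (2 * r) p g)
     \<le> ennreal (2 * s) * (ennreal \<kappa> * ennreal ((2 * (2 * s)) ^ CARD('n)) + ennreal (\<kappa> powr (1 - p)) * ennreal E)"
    using E s by (subst emeasure_cube) (auto intro!: mult_left_mono add_left_mono)
  also have "\<dots> = ennreal (2 * s * (\<kappa> * (2 * (2 * s)) ^ CARD('n) + \<kappa> powr (1 - p) * E))"
    using s \<kappa> E by (simp add: ennreal_mult)
  finally have "\<bar>LINT z:D|lebesgue. g z * ?\<psi> z\<bar> \<le> 2 * s * (\<kappa> * (2 * (2 * s)) ^ CARD('n) + \<kappa> powr (1 - p) * E)"
    using s \<kappa> E by (subst (asm) ennreal_le_iff) auto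
  also have "\<kappa> * (2 * (2 * s)) ^ CARD('n) = 4 ^ CARD('n) * s powr (n - n / p)"
    using s by (simp add: \<kappa>_def n_def power_mult_distrib powr_realpow[symmetric] powr_add[symmetric])
  also have "\<kappa> powr (1 - p) = s powr (n - n / p)"
  proof -
    have "- (n / p) * (1 - p) = n - n / p" using n by (simp add: field_simps)
    then show ?thesis by (simp only: \<kappa>_def powr_powr)
  qed
  also have "2 * s * (4 ^ CARD('n) * s powr (n - n / p) + s powr (n - n / p) * E)
      = 2 * (4 ^ CARD('n) + E) * (s powr 1 * s powr (n - n / p))"
    using s by (simp add: algebra_simps)
  also have "s powr 1 * s powr (n - n / p) = s powr (1 + n - n / p)"
    by (simp only: powr_add[symmetric] add_diff_eq)
  finally show ?thesis by (simp add: n_def)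
qed


lemma cube_dilate: "w \<in> cube 0 2 \<Longrightarrow> 0 \<le> s \<Longrightarrow> s \<le> r \<Longrightarrow> a + s *\<^sub>R w \<in> cube a (2 * r)"
proof -
  assume w: "w \<in> cube 0 2" and s: "0 \<le> s" "s \<le> r"
  have "s * \<bar>w $ j\<bar> \<le> r * 2" for j
    using w s by (intro mult_mono) (auto simp: mem_cube)
  then show "a + s *\<^sub>R w \<in> cube a (2 * r)"
    using s by (simp add: mem_cube abs_mult mult.commute)
qed

text \<open>The domain stays the cube of radius 2r for every scale s, because the kernel vanishes
  off the cube of radius 2s; so only the integrand is differentiated. The derivative of the kernel
  is minus a divergence, and the weak derivative identity contributes a second minus sign, which
  cancels the first.\<close>

lemma dilated_average_has_derivative:
  fixes u :: "real^'n \<Rightarrow> real"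
  assumes \<beta>: "smooth_fun \<beta>" "\<And>w. w \<notin> cube 0 2 \<Longrightarrow> \<beta> w = 0"
    and s: "0 < s" "s \<le> r" and D: "cube a (2 * r) \<subseteq> D"
    and u: "continuous_on D u" "\<And>j. weak_partial D j u (g j)"
  shows "((\<lambda>s. integral (cube a (2 * r)) (\<lambda>z. u z * (\<beta> ((z - a) /\<^sub>R s) / s ^ CARD('n)))) has_vector_derivative
     (\<Sum>j\<in>UNIV. LINT z:D|lebesgue. g j z * ((z $ j - a $ j) * \<beta> ((z - a) /\<^sub>R s))) / s ^ Suc CARD('n)) (at s)"
proof -
  let ?\<psi> = "\<lambda>j s z. (z $ j - a $ j) * \<beta> ((z - a) /\<^sub>R s)"
  let ?d = "\<lambda>j s z. frechet_derivative (?\<psi> j s) (at z) (axis j 1)"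
  let ?Q = "cube a (2 * r)"
  define \<beta>' where "\<beta>' j w = frechet_derivative \<beta> (at w) (axis j 1)" for j w
  have uQ: "continuous_on ?Q u" using u(1) D continuous_on_subset by blast
  have c\<beta>: "continuous_on A (\<lambda>x. \<beta> (f x))" if "continuous_on A f" for A :: "'c::topological_space set" and f
    using smooth_fun_continuous[OF \<beta>(1)] that by (rule continuous_on_compose2) auto
  have c\<beta>': "continuous_on A (\<lambda>x. \<beta>' j (f x))" if "continuous_on A f" for A :: "'c::topological_space set" and f j
    using smooth_fun_has_derivative(2)[OF \<beta>(1)] that unfolding \<beta>'_def
    by (rule continuous_on_compose2) auto
  have d: "?d j s z = (z $ j - a $ j) / s * \<beta>' j ((z - a) /\<^sub>R s) + \<beta> ((z - a) /\<^sub>R s)" if "0 < s" for j s z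
    using that dilation_partial[OF \<beta>(1), of s j a z] by (simp add: \<beta>'_def)
  \<comment> \<open>Joint continuity in (s, z) is what the Leibniz rule asks for. It is read off
    from the explicit formula \<open>d\<close>, which is available for s > 0.\<close>
  have cd: "continuous_on ({0<..} \<times> ?Q) (\<lambda>(s, z). u z * (- (\<Sum>j\<in>UNIV. ?d j s z) / s ^ Suc CARD('n)))"
  proof -
    have "continuous_on ({0<..} \<times> ?Q) (\<lambda>x. u (snd x) * (- (\<Sum>j\<in>UNIV. (snd x $ j - a $ j) / fst x * \<beta>' j ((snd x - a) /\<^sub>R fst x) + \<beta> ((snd x - a) /\<^sub>R fst x)) / fst x ^ Suc CARD('n)))"
      by (intro continuous_intros c\<beta> c\<beta>' continuous_on_compose2[OF uQ, of _ snd]) auto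
    then show ?thesis
      by (rule continuous_on_eq) (auto simp: d)
  qed
  have der: "((\<lambda>s. integral ?Q (\<lambda>z. u z * (\<beta> ((z - a) /\<^sub>R s) / s ^ CARD('n)))) has_vector_derivative
      integral ?Q (\<lambda>z. u z * (- (\<Sum>j\<in>UNIV. ?d j s z) / s ^ Suc CARD('n)))) (at s within {0<..})"
    unfolding cube_def
  proof (rule leibniz_rule_vector_derivative)
    fix s :: real and z
    assume s: "s \<in> {0<..}"
    show "((\<lambda>s. u z * (\<beta> ((z - a) /\<^sub>R s) / s ^ CARD('n))) has_vector_derivative
         u z * (- (\<Sum>j\<in>UNIV. ?d j s z) / s ^ Suc CARD('n))) (at s within {0<..})"
      using s by (intro has_vector_derivative_mult_right has_vector_derivative_at_within[OF dilation_has_derivative[OF \<beta>(1)]]) simp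
  next
    fix s :: real
    assume s: "s \<in> {0<..}"
    have "continuous_on ?Q (\<lambda>z. u z * (\<beta> ((z - a) /\<^sub>R s) / s ^ CARD('n)))"
      using s by (intro continuous_intros uQ c\<beta>) auto
    then show "(\<lambda>z. u z * (\<beta> ((z - a) /\<^sub>R s) / s ^ CARD('n))) integrable_on cbox (a - (2 * r) *\<^sub>R 1) (a + (2 * r) *\<^sub>R 1)"
      unfolding cube_def by (rule integrable_continuous)
  qed (use cd s in \<open>auto simp: cube_def\<close>)
  have Qs: "cube a (2 * s) \<subseteq> ?Q" using s by (intro cube_mono) auto
  then have QsD: "cube a (2 * s) \<subseteq> D" using D by blast
  have 0: "?d j s z = 0" if "z \<notin> cube a (2 * s)" for j z
  proof (rule frechet_derivative_outside_support)
    have "closure {z. ?\<psi> j s z \<noteq> 0} \<subseteq> cube a (2 * s)"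
      using test_fun_dilation(2)[OF \<beta>(1) _ s(1) QsD] \<beta>(2)
      by (intro closure_minimal compact_imp_closed[OF compact_cube]) force
    then show "z \<notin> closure {z. ?\<psi> j s z \<noteq> 0}" using that by blast
  qed
  have lu: "locally_integrable D u" using u(2) unfolding weak_partial_def by blast
  have part: "(\<lambda>z. u z * ?d j s z) integrable_on ?Q"
    "integral ?Q (\<lambda>z. u z * ?d j s z) = - (LINT z:D|lebesgue. g j z * ?\<psi> j s z)" for j
  proof -
    have tst: "test_fun D (?\<psi> j s)"
      by (rule test_fun_dilation(1)[OF \<beta>(1) _ s(1) QsD]) (rule \<beta>(2))
    have c: "continuous_on UNIV (?d j s)"
      using tst unfolding test_fun_def by (intro smooth_fun_has_derivative(2)) blast
    have uQ: "set_integrable lebesgue ?Q u"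
      using lu D compact_cube unfolding locally_integrable_def by blast
    have 0: "?d j s z = 0" if "z \<notin> ?Q" for z using 0 Qs that by blast
    have "set_integrable lebesgue ?Q (\<lambda>z. u z * ?d j s z)"
      by (rule integrable_mult_compact_support(1)[OF uQ compact_cube order_refl c 0])
    note this[THEN set_lebesgue_integral_eq_integral(1)] this[THEN set_lebesgue_integral_eq_integral(2)]
    moreover have "(LINT z:D|lebesgue. u z * ?d j s z) = (LINT z:?Q|lebesgue. u z * ?d j s z)"
      by (rule integrable_mult_compact_support(2)[OF uQ compact_cube D c 0])
    moreover have "(LINT z:D|lebesgue. u z * ?d j s z) = - (LINT z:D|lebesgue. g j z * ?\<psi> j s z)"
      using u(2)[of j] tst unfolding weak_partial_def by blast
    ultimately show "(\<lambda>z. u z * ?d j s z) integrable_on ?Q"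
      "integral ?Q (\<lambda>z. u z * ?d j s z) = - (LINT z:D|lebesgue. g j z * ?\<psi> j s z)" by simp_all
  qed
  have "integral ?Q (\<lambda>z. u z * (- (\<Sum>j\<in>UNIV. ?d j s z) / s ^ Suc CARD('n)))
      = integral ?Q (\<lambda>z. (- 1 / s ^ Suc CARD('n)) * (\<Sum>j\<in>UNIV. u z * ?d j s z))"
    by (rule integral_cong) (simp add: sum_distrib_left sum_negf sum_divide_distrib)
  also have "\<dots> = (- 1 / s ^ Suc CARD('n)) * (\<Sum>j\<in>UNIV. integral ?Q (\<lambda>z. u z * ?d j s z))"
    using part(1) by (simp add: integral_sum)
  also have "\<dots> = (\<Sum>j\<in>UNIV. LINT z:D|lebesgue. g j z * ?\<psi> j s z) / s ^ Suc CARD('n)"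
    by (simp add: part(2) sum_negf)
  finally show ?thesis
    using der s by (simp add: at_within_open[of s "{0<..}"])
qed

text \<open>The average is followed from scale r down to scale 0, where it becomes u(a) times the
  integral of \<beta>. Its derivative is at most K s^(-\<sigma>) with \<sigma> = n/p < 1, and
  integrating this from 0 to r gives the stated power of r.\<close>

lemma morrey_estimate:
  fixes u :: "real^'n \<Rightarrow> real"
  assumes \<beta>: "smooth_fun \<beta>" "\<And>w. w \<notin> cube 0 2 \<Longrightarrow> \<beta> w = 0" "\<And>w. \<bar>\<beta> w\<bar> \<le> 1"
    and r: "0 < r" and D: "cube a (2 * r) \<subseteq> D"
    and u: "continuous_on D u" "\<And>j. weak_partial D j u (g j)"
    and p: "real CARD('n) < p"
    and E: "\<And>j. local_energy a (2 * r) p (g j) \<le> ennreal E" "0 \<le> E"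
  shows "\<bar>integral (cube a (2 * r)) (\<lambda>z. u z * \<beta> ((z - a) /\<^sub>R r)) / r ^ CARD('n) - u a * integral (cube 0 2) \<beta>\<bar>
     \<le> 2 * real CARD('n) * (4 ^ CARD('n) + E) / (1 - real CARD('n) / p) * r powr (1 - real CARD('n) / p)"
proof -
  define K where "K = 2 * real CARD('n) * (4 ^ CARD('n) + E)"
  define \<sigma> where "\<sigma> = real CARD('n) / p"
  have \<sigma>: "\<sigma> < 1" using p by (simp add: \<sigma>_def)
  let ?Q = "cube a (2 * r)"
  define V where "V s = integral ?Q (\<lambda>z. u z * (\<beta> ((z - a) /\<^sub>R s) / s ^ CARD('n)))" for s
  define W where "W s = integral (cube 0 2) (\<lambda>w. u (a + s *\<^sub>R w) * \<beta> w)" for s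
  have uQ: "continuous_on ?Q u" using u(1) D continuous_on_subset by blast
  have c\<beta>: "continuous_on A (\<lambda>x. \<beta> (f x))" if "continuous_on A f" for A :: "'c::topological_space set" and f
    using smooth_fun_continuous[OF \<beta>(1)] that by (rule continuous_on_compose2) auto
  have cW: "continuous_on ({0..r} \<times> cube 0 2) (\<lambda>(s, w). u (a + s *\<^sub>R w) * \<beta> w)"
    unfolding case_prod_unfold
    by (intro continuous_intros c\<beta> continuous_on_compose2[OF uQ]) (auto intro: cube_dilate)
  then have W: "continuous_on {0..r} W"
    unfolding W_def cube_def by (rule integral_continuous_on_param)
  \<comment> \<open>Two forms of one average, related by z = a + s w: \<open>V\<close> has the known
    derivative but divides by s, while \<open>W\<close> is continuous down to s = 0.\<close>
  have VW: "V s = W s" if s: "0 < s" "s \<le> r" for s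
  proof -
    have "continuous_on (cube 0 2) (\<lambda>w. u (a + s *\<^sub>R w) * \<beta> w)"
      using s by (intro continuous_intros c\<beta> continuous_on_compose2[OF uQ]) (auto intro: cube_dilate)
    then have h: "((\<lambda>w. u (a + s *\<^sub>R w) * \<beta> w) has_integral W s) (cube 0 2)"
      unfolding W_def cube_def by (intro integrable_integral integrable_continuous)
    \<comment> \<open>The domain is enlarged so that its image under w -> a + s w is exactly the
      fixed cube over which \<open>V\<close> integrates; \<beta> vanishes on the added part.\<close>
    have "cube 0 2 \<subseteq> (cube 0 (2 * r / s) :: (real^'n) set)"
      using s by (intro cube_mono) (simp add: divide_simps)
    then have "((\<lambda>w. u (a + s *\<^sub>R w) * \<beta> w) has_integral W s) (cube 0 (2 * r / s))"
      by (rule has_integral_on_superset[OF h, rotated]) (simp add: \<beta>(2))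
    then have c: "((\<lambda>w. u (s *\<^sub>R w + a) * \<beta> (((s *\<^sub>R w + a) - a) /\<^sub>R s)) has_integral W s)
       (cbox ((a - (2 * r) *\<^sub>R 1 - a) /\<^sub>R s) ((a + (2 * r) *\<^sub>R 1 - a) /\<^sub>R s))"
      using s by (simp add: add.commute cube_def divide_inverse_commute)
    have e: "(W s * s ^ CARD('n)) /\<^sub>R s ^ DIM(real^'n) = W s" using s by simp
    have "((\<lambda>w. u (s *\<^sub>R w + a) * \<beta> (((s *\<^sub>R w + a) - a) /\<^sub>R s)) has_integral (W s * s ^ CARD('n)) /\<^sub>R s ^ DIM(real^'n))
       (cbox ((a - (2 * r) *\<^sub>R 1 - a) /\<^sub>R s) ((a + (2 * r) *\<^sub>R 1 - a) /\<^sub>R s))"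
      using c by (simp only: e)
    then have "((\<lambda>z. u z * \<beta> ((z - a) /\<^sub>R s)) has_integral W s * s ^ CARD('n)) ?Q"
      unfolding cube_def using has_integral_affinity_iff[OF s(1), of "\<lambda>z. u z * \<beta> ((z - a) /\<^sub>R s)" a] by blast
    then have "((\<lambda>z. u z * \<beta> ((z - a) /\<^sub>R s) / s ^ CARD('n)) has_integral W s * s ^ CARD('n) / s ^ CARD('n)) ?Q"
      by (rule has_integral_divide)
    from integral_unique[OF this] show ?thesis using s by (simp add: V_def)
  qed
  \<comment> \<open>The derivative bound blows up at s = 0, so the mean value inequality is used in
    the form that compares derivatives on the open interval only. The comparison function is the
    primitive of K s^(-\<sigma>).\<close>
  have "norm (W r - W 0) \<le> K / (1 - \<sigma>) * r powr (1 - \<sigma>) - K / (1 - \<sigma>) * 0 powr (1 - \<sigma>)"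
  proof (rule differentiable_bound_general[OF r W])
    show "continuous_on {0..r} (\<lambda>s. K / (1 - \<sigma>) * s powr (1 - \<sigma>))"
      using \<sigma> by (intro continuous_intros continuous_on_powr') auto
    fix s assume s: "0 < s" "s < r"
    have "((\<lambda>s. K / (1 - \<sigma>) * s powr (1 - \<sigma>)) has_real_derivative
        K / (1 - \<sigma>) * ((1 - \<sigma>) * s powr (1 - \<sigma> - 1))) (at s)"
      using s by (intro DERIV_cmult has_real_derivative_powr)
    then show "((\<lambda>s. K / (1 - \<sigma>) * s powr (1 - \<sigma>)) has_vector_derivative K * s powr (- \<sigma>)) (at s)"
      using \<sigma> by (simp add: has_real_derivative_iff_has_vector_derivative)
    let ?L = "\<lambda>j. LINT z:D|lebesgue. g j z * ((z $ j - a $ j) * \<beta> ((z - a) /\<^sub>R s))"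
    have "(V has_vector_derivative (\<Sum>j\<in>UNIV. ?L j) / s ^ Suc CARD('n)) (at s)"
      unfolding V_def using s
      by (intro dilated_average_has_derivative[OF \<beta>(1) _ _ _ D u] \<beta>(2)) auto
    then show "(W has_vector_derivative (\<Sum>j\<in>UNIV. ?L j) / s ^ Suc CARD('n)) (at s)"
      by (rule has_vector_derivative_transform_within_open[of _ _ _ "{0<..<r}"]) (use s VW in auto)
    have lg: "locally_integrable D (g j)" for j
      using u(2) unfolding weak_partial_def by blast
    have L: "\<bar>?L j\<bar> \<le> 2 * (4 ^ CARD('n) + E) * s powr (1 + real CARD('n) - \<sigma>)" for j
      unfolding \<sigma>_def
      by (rule weighted_integral_bound[OF \<beta>(1) _ \<beta>(3) s(1) less_imp_le[OF s(2)] D lg p E(1) E(2)])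
         (rule \<beta>(2))
    have "\<bar>\<Sum>j\<in>UNIV. ?L j\<bar> \<le> (\<Sum>j\<in>UNIV. \<bar>?L j\<bar>)" by (rule sum_abs)
    also have "\<dots> \<le> (\<Sum>j\<in>(UNIV::'n set). 2 * (4 ^ CARD('n) + E) * s powr (1 + real CARD('n) - \<sigma>))"
      by (rule sum_mono) (rule L)
    also have "\<dots> = real CARD('n) * (2 * (4 ^ CARD('n) + E) * s powr (1 + real CARD('n) - \<sigma>))"
      by simp
    also have "\<dots> = K * s powr (- \<sigma>) * s ^ Suc CARD('n)"
      using s by (simp add: K_def powr_realpow[symmetric] powr_add[symmetric] algebra_simps del: power_Suc)
    finally show "norm ((\<Sum>j\<in>UNIV. ?L j) / s ^ Suc CARD('n)) \<le> K * s powr (- \<sigma>)"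
      using s by (simp add: divide_le_eq del: power_Suc)
  qed
  moreover have "W 0 = u a * integral (cube 0 2) \<beta>"
    by (simp add: W_def)
  moreover have "W r = integral ?Q (\<lambda>z. u z * \<beta> ((z - a) /\<^sub>R r)) / r ^ CARD('n)"
    using VW[of r] r by (simp add: V_def)
  ultimately show ?thesis by (simp add: K_def \<sigma>_def)
qed

section \<open>Equicontinuity and subsequences\<close>

text \<open>For $T/2 \le t \le T$ one has $t/\varphi(t) \ge (T/2)/\varphi(T)$, so the integral bounds
  $T^{1+\alpha}/\varphi(T)^\alpha$.\<close>

lemma energy_growth:
  fixes \<phi> :: "ennreal \<Rightarrow> ennreal"
  assumes mono: "mono \<phi>" and tstar: "Sup {t. \<phi> t = 0} < ennreal t\<^sub>0" and \<alpha>: "0 < \<alpha>"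
    and int: "(\<integral>\<^sup>+ t\<in>{t\<^sub>0..}. ennreal ((t / enn2real (\<phi> (ennreal t))) powr \<alpha>) \<partial>lborel) < \<infinity>"
  obtains A B where "0 \<le> A" "0 \<le> B"
    "\<And>t. 0 \<le> t \<Longrightarrow> ennreal (t powr (1 + 1 / \<alpha>)) \<le> ennreal A * \<phi> (ennreal t) + ennreal B"
proof -
  define h where "h t = (t / enn2real (\<phi> (ennreal t))) powr \<alpha>" for t
  define p where "p = 1 + 1 / \<alpha>"
  have p: "0 < p" using \<alpha> by (simp add: p_def add_pos_pos)
  \<comment> \<open>\<open>t\<^sub>0\<close> plays the part of t_star in the theorem. It is positive
    because it lies strictly above a supremum in [0,\<infinity>].\<close>
  have t0: "0 < t\<^sub>0"
    using tstar by (metis ennreal_less_zero_iff gr_zeroI not_less_zero)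
  \<comment> \<open>The added 1 keeps the final constant positive, so that its product with
    \<phi>(T) = \<infinity> is still infinite.\<close>
  define J where "J = enn2real (\<integral>\<^sup>+ t\<in>{t\<^sub>0..}. ennreal (h t) \<partial>lborel) + 1"
  have J: "1 \<le> J" by (simp add: J_def)
  have intJ: "(\<integral>\<^sup>+ t\<in>{t\<^sub>0..}. ennreal (h t) \<partial>lborel) \<le> ennreal J"
    using int by (simp add: J_def h_def ennreal_plus less_top)
  \<comment> \<open>With T at least twice \<open>t\<^sub>0\<close>, the whole interval [T/2, T] lies
    in the range of integration.\<close>
  have large: "ennreal (T powr p) \<le> ennreal (2 powr p * J powr (1 / \<alpha>)) * \<phi> (ennreal T)"
    if T: "2 * t\<^sub>0 \<le> T" for T
  proof (cases "\<phi> (ennreal T)" rule: ennreal_cases)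
    case (real y)
    have T0: "0 < T" using T t0 by linarith
    have pos: "\<phi> (ennreal t) \<noteq> 0" if "t\<^sub>0 \<le> t" for t
    proof
      assume "\<phi> (ennreal t) = 0"
      then have "ennreal t \<le> Sup {t. \<phi> t = 0}" by (intro Sup_upper) simp
      then show False using tstar that by (metis ennreal_leI leD order_trans)
    qed
    have y: "0 < y" using pos[of T] real T t0 by (cases "y = 0") auto
    have h: "(T / 2 / y) powr \<alpha> \<le> h t" if t: "T / 2 \<le> t" "t \<le> T" for t
    proof -
      \<comment> \<open>\<open>enn2real\<close> is exact here: monotonicity keeps \<phi>(t) finite
        and \<open>pos\<close> keeps it nonzero. Where \<phi> is infinite, \<open>enn2real\<close>
        gives 0 and division by 0 gives 0, in agreement with t/\<infinity> = 0.\<close>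
      have "\<phi> (ennreal t) \<le> ennreal y"
        using monoD[OF mono, of "ennreal t" "ennreal T"] t real by (simp add: ennreal_leI)
      moreover have "\<phi> (ennreal t) \<noteq> 0" using pos t T by simp
      ultimately obtain x where x: "\<phi> (ennreal t) = ennreal x" "0 < x" "x \<le> y"
        using y by (cases "\<phi> (ennreal t)" rule: ennreal_cases) (auto simp: top_unique)
      then have "T / 2 / y \<le> t / x"
        using t T0 by (intro frac_le) auto
      then show ?thesis
        unfolding h_def using x T0 y \<alpha> by (intro powr_mono2) auto
    qed
    have "ennreal ((T / 2 / y) powr \<alpha> * (T / 2)) = (\<integral>\<^sup>+ t\<in>{T/2..T}. ennreal ((T / 2 / y) powr \<alpha>) \<partial>lborel)"
      using T0 by (simp add: nn_integral_cmult ennreal_mult[symmetric])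
    also have "\<dots> \<le> (\<integral>\<^sup>+ t\<in>{t\<^sub>0..}. ennreal (h t) \<partial>lborel)"
      using h T by (intro nn_integral_mono) (auto simp: indicator_def intro!: ennreal_leI)
    finally have "(T / 2 / y) powr \<alpha> * (T / 2) \<le> J"
      using intJ J by (metis ennreal_le_iff order_trans zero_le_one)
    \<comment> \<open>The power 1/\<alpha> isolates y: the left side becomes (T/2)^p / y, because p
      = 1 + 1/\<alpha>.\<close>
    then have "((T / 2 / y) powr \<alpha> * (T / 2)) powr (1 / \<alpha>) \<le> J powr (1 / \<alpha>)"
      using T0 \<alpha> by (intro powr_mono2) auto
    moreover have "((T / 2 / y) powr \<alpha> * (T / 2)) powr (1 / \<alpha>) = T / 2 / y * (T / 2) powr (1 / \<alpha>)"
      using T0 y \<alpha> by (subst powr_mult) (auto simp: powr_powr)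
    ultimately have "T / 2 / y * (T / 2) powr (1 / \<alpha>) \<le> J powr (1 / \<alpha>)" by simp
    then have "(T / 2) * (T / 2) powr (1 / \<alpha>) \<le> J powr (1 / \<alpha>) * y"
      using y by (simp add: field_simps)
    then have "2 powr p * ((T / 2) * (T / 2) powr (1 / \<alpha>)) \<le> 2 powr p * (J powr (1 / \<alpha>) * y)"
      by (rule mult_left_mono) simp
    also have "(T / 2) * (T / 2) powr (1 / \<alpha>) = T powr p / 2 powr p"
      using T0 unfolding p_def by (subst powr_divide[symmetric]) (auto simp: powr_add)
    finally have "T powr p \<le> 2 powr p * J powr (1 / \<alpha>) * y" by simp
    then show ?thesis
      using y real J by (simp add: ennreal_mult[symmetric] ennreal_leI)
  next
    case top
    have "0 < 2 powr p * J powr (1 / \<alpha>)" using J by simp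
    then show ?thesis using top J by (auto simp: ennreal_mult_top)
  qed
  show thesis
  proof (rule that[of "2 powr p * J powr (1 / \<alpha>)" "(2 * t\<^sub>0) powr p"])
    fix t :: real assume t: "0 \<le> t"
    show "ennreal (t powr (1 + 1 / \<alpha>)) \<le> ennreal (2 powr p * J powr (1 / \<alpha>)) * \<phi> (ennreal t) + ennreal ((2 * t\<^sub>0) powr p)"
    proof (cases "2 * t\<^sub>0 \<le> t")
      case True
      then show ?thesis using large[OF True] by (simp add: p_def add_increasing2)
    next
      case False
      then have "ennreal (t powr p) \<le> ennreal ((2 * t\<^sub>0) powr p)"
        using t p by (intro ennreal_leI powr_mono2) auto
      then show ?thesis by (simp add: p_def add_increasing)
    qed
  qed auto
qed

section \<open>From the energy bound to local L^p bounds on the gradient\<close>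

text \<open>Local integrability gives measurability on compact subsets of D; a pointwise limit along
  a compact exhaustion gives it on D. The indicator is essential, since u is arbitrary outside
  D.\<close>

lemma locally_integrable_measurable:
  fixes u :: "real^'n \<Rightarrow> real"
  assumes "open D" "locally_integrable D u"
  shows "(\<lambda>x. indicator D x * u x) \<in> borel_measurable lebesgue"
proof -
  obtain C where C: "\<And>n. compact (C n)" "\<And>n. C n \<subseteq> D" "\<And>n. C n \<subseteq> interior (C (Suc n))"
    "\<Union> (range C) = D" "\<And>K. compact K \<Longrightarrow> K \<subseteq> D \<Longrightarrow> \<exists>N. \<forall>n\<ge>N. K \<subseteq> C n"
    using open_Union_compact_subsets[OF assms(1)] by metis
  show ?thesis
  proof (rule borel_measurable_LIMSEQ_real)
    show "(\<lambda>n. indicator (C n) x *\<^sub>R u x) \<longlonglongrightarrow> indicator D x * u x" for x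
    proof (cases "x \<in> D")
      case True
      then obtain N where "\<forall>n\<ge>N. x \<in> C n" using C(5)[of "{x}"] by auto
      then show ?thesis
        using True by (intro tendsto_eventually) (auto simp: eventually_sequentially intro!: exI[of _ N])
    next
      case False
      then have "x \<notin> C n" for n using C(2) by blast
      with False show ?thesis by simp
    qed
    show "(\<lambda>x. indicator (C n) x *\<^sub>R u x) \<in> borel_measurable lebesgue" for n
      using assms(2) C(1,2)[of n] unfolding locally_integrable_def set_integrable_def by blast
  qed
qed

lemma grad_norm_indicator:
  "indicator D x * \<phi> (ennreal (grad_norm (\<lambda>i j x. indicator D x * g i j x) x)) = indicator D x * \<phi> (ennreal (grad_norm g x))"
  for \<phi> :: "ennreal \<Rightarrow> ennreal"
  by (cases "x \<in> D") (auto simp: grad_norm_def)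

text \<open>The entries of g are unrestricted outside D. Moving the indicator inside the gradient
  norm makes the argument of \<phi> measurable, and the outer indicator hides the values thereby
  changed.\<close>

lemma measurable_energy_density:
  fixes \<phi> :: "ennreal \<Rightarrow> ennreal" and g :: "'m::finite \<Rightarrow> 'n::finite \<Rightarrow> real^'n \<Rightarrow> real"
  assumes D: "open D" and g: "\<And>i j. locally_integrable D (g i j)" and \<phi>: "\<phi> \<in> borel_measurable borel"
  shows "(\<lambda>x. \<phi> (ennreal (grad_norm g x)) * indicator D x) \<in> borel_measurable lebesgue"
proof -
  note [measurable] = locally_integrable_measurable[OF D g] \<phi>
  have [measurable]: "D \<in> sets lebesgue" using D by (simp add: borel_open)
  have "(\<lambda>x. indicator D x * \<phi> (ennreal (grad_norm (\<lambda>i j x. indicator D x * g i j x) x))) \<in> borel_measurable lebesgue"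
    unfolding grad_norm_def by measurable
  then show ?thesis by (simp add: grad_norm_indicator mult.commute)
qed

lemma abs_le_grad_norm: "\<bar>g i j x\<bar> \<le> grad_norm g x"
proof -
  have "(g i j x)\<^sup>2 \<le> (\<Sum>j\<in>UNIV. (g i j x)\<^sup>2)"
    by (rule member_le_sum) auto
  also have "\<dots> \<le> (\<Sum>i\<in>UNIV. \<Sum>j\<in>UNIV. (g i j x)\<^sup>2)"
    by (rule member_le_sum[of i UNIV "\<lambda>i. \<Sum>j\<in>UNIV. (g i j x)\<^sup>2"]) (auto intro: sum_nonneg)
  finally show ?thesis
    unfolding grad_norm_def by (metis real_le_rsqrt power2_abs)
qed

text \<open>The additive constant B in the growth estimate contributes B times the volume, so the
  bound is for a bounded cube and grows with it.\<close>

lemma local_energy_bound: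
  fixes g :: "'m::finite \<Rightarrow> 'n::finite \<Rightarrow> real^'n \<Rightarrow> real" and \<phi> :: "ennreal \<Rightarrow> ennreal"
  assumes D: "open D" and g: "\<And>i j. locally_integrable D (g i j)" and \<phi>: "\<phi> \<in> borel_measurable borel"
    and AB: "0 \<le> A" "0 \<le> B" "\<And>t. 0 \<le> t \<Longrightarrow> ennreal (t powr p) \<le> ennreal A * \<phi> (ennreal t) + ennreal B"
    and M: "(\<integral>\<^sup>+ x\<in>D. \<phi> (ennreal (grad_norm g x)) \<partial>lebesgue) \<le> ennreal M" "0 \<le> M"
    and p: "0 \<le> p" and \<rho>: "0 \<le> \<rho>" "cube a \<rho> \<subseteq> D"
  shows "local_energy a \<rho> p (g i j) \<le> ennreal (A * M + B * (2 * \<rho>) ^ CARD('n))"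
proof -
  note [measurable] = measurable_energy_density[OF D g \<phi>]
  have [measurable]: "cube a \<rho> \<in> sets lebesgue" by (simp add: cube_def)
  have "local_energy a \<rho> p (g i j) \<le> (\<integral>\<^sup>+x. ennreal A * (\<phi> (ennreal (grad_norm g x)) * indicator D x)
      + ennreal B * indicator (cube a \<rho>) x \<partial>lebesgue)"
    unfolding local_energy_def
  proof (rule nn_integral_mono)
    fix x
    have "ennreal (\<bar>g i j x\<bar> powr p) \<le> ennreal (grad_norm g x powr p)"
      using p abs_le_grad_norm by (intro ennreal_leI powr_mono2) auto
    also have "\<dots> \<le> ennreal A * \<phi> (ennreal (grad_norm g x)) + ennreal B"
      by (rule AB(3)) (auto simp: grad_norm_def intro!: sum_nonneg)
    finally show "ennreal (\<bar>g i j x\<bar> powr p) * indicator (cube a \<rho>) x \<le> ennreal A * (\<phi> (ennreal (grad_norm g x)) * indicator D x)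
      + ennreal B * indicator (cube a \<rho>) x"
      using \<rho>(2) by (auto simp: indicator_def)
  qed
  also have "\<dots> = ennreal A * (\<integral>\<^sup>+ x\<in>D. \<phi> (ennreal (grad_norm g x)) \<partial>lebesgue) + ennreal B * emeasure lebesgue (cube a \<rho>)"
    by (subst nn_integral_add) (auto simp: nn_integral_cmult)
  also have "\<dots> \<le> ennreal A * ennreal M + ennreal B * ennreal ((2 * \<rho>) ^ CARD('n))"
    using M by (subst emeasure_cube[OF \<rho>(1)]) (auto intro!: add_mono mult_left_mono)
  also have "\<dots> = ennreal (A * M + B * (2 * \<rho>) ^ CARD('n))"
    using AB M \<rho> by (simp add: ennreal_mult)
  finally show ?thesis .
qed

section \<open>Translated cubes and the mass of the bump\<close>

lemma cube_commute: "z \<in> cube x \<rho> \<longleftrightarrow> x \<in> cube z \<rho>"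
  by (simp add: mem_cube abs_minus_commute)

lemma cube_trans:
  assumes "z \<in> cube x \<rho>" "x \<in> cube a \<sigma>"
  shows "z \<in> cube a (\<rho> + \<sigma>)"
  unfolding mem_cube
proof
  fix j
  have "\<bar>z $ j - x $ j\<bar> \<le> \<rho>" "\<bar>x $ j - a $ j\<bar> \<le> \<sigma>"
    using assms by (auto simp: mem_cube)
  then show "\<bar>z $ j - a $ j\<bar> \<le> \<rho> + \<sigma>" by linarith
qed

lemma cube_uminus: "- v \<in> cube 0 \<rho> \<longleftrightarrow> v \<in> cube 0 \<rho>"
  by (simp add: mem_cube)

lemma cube_shift: "w + v \<in> cube 0 \<rho> \<longleftrightarrow> w \<in> cube (- v) \<rho>"
  by (simp add: mem_cube)

lemma bump_outside_cube: "w \<notin> cube 0 1 \<Longrightarrow> bump w = 0"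
  using bump_eq_0[of w] by (fastforce simp: mem_cube not_le dest: less_imp_le)

lemma integral_bump_pos: "0 < integral (cube 0 1) (bump :: real^'n \<Rightarrow> real)"
proof -
  let ?b = "bump :: real^'n \<Rightarrow> real"
  have c: "continuous_on (cube 0 1) ?b"
    using smooth_fun_continuous[OF smooth_bump] continuous_on_subset by blast
  then have i: "?b integrable_on cube 0 1"
    unfolding cube_def by (rule integrable_continuous)
  have "integral (cube 0 1) ?b \<noteq> 0"
  proof
    assume "integral (cube 0 1) ?b = 0"
    then have "(?b has_integral 0) (cube 0 1)" using i by (metis integrable_integral)
    moreover have "box (0 - 1 *\<^sub>R 1) (0 + 1 *\<^sub>R 1 :: real^'n) \<noteq> {}"
      by (auto simp: box_ne_empty inner_axis Basis_vec_def)
    ultimately have "?b 0 = 0"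
      using c bump_bounds(1) unfolding cube_def
      by (intro has_integral_0_cbox_imp_0[of "0 - 1 *\<^sub>R 1" "0 + 1 *\<^sub>R 1" ?b]) (auto simp: mem_box_cart)
    then show False using bump_0_pos by (metis less_irrefl)
  qed
  moreover have "0 \<le> integral (cube 0 1) ?b"
    using i bump_bounds(1) by (intro integral_nonneg) auto
  ultimately show ?thesis by simp
qed

text \<open>The bump lives in the cube of radius 1, while admissible kernels may live in radius 2:
  this margin leaves room for a translation by any v in the unit cube, and the total mass is
  unchanged.\<close>

lemma integral_bump_shift:
  fixes v :: "real^'n"
  assumes "v \<in> cube 0 1"
  shows "integral (cube 0 2) (\<lambda>w. bump (w + v)) = integral (cube 0 1) (bump :: real^'n \<Rightarrow> real)"
proof -
  let ?I = "integral (cube 0 1) (bump :: real^'n \<Rightarrow> real)"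
  have "continuous_on (cube 0 1) (bump :: real^'n \<Rightarrow> real)"
    using smooth_fun_continuous[OF smooth_bump] continuous_on_subset by blast
  then have "(bump has_integral ?I) (cube 0 1 :: (real^'n) set)"
    unfolding cube_def by (intro integrable_integral integrable_continuous)
  then have "((\<lambda>w. bump (1 *\<^sub>R w + v)) has_integral ?I /\<^sub>R 1 ^ DIM(real^'n))
     (cbox ((0 - 1 *\<^sub>R 1 - v) /\<^sub>R 1) ((0 + 1 *\<^sub>R 1 - v) /\<^sub>R 1))"
    unfolding cube_def by (rule has_integral_affinity') simp
  then have h: "((\<lambda>w. bump (w + v)) has_integral ?I) (cube (- v) 1)"
    by (simp add: cube_def minus_diff_commute)
  have "((\<lambda>w. bump (w + v)) has_integral ?I) (cube 0 2)"
  proof (rule has_integral_on_superset[OF h])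
    show "bump (w + v) = 0" if "w \<notin> cube (- v) 1" for w
      using that bump_outside_cube cube_shift by blast
    show "cube (- v) 1 \<subseteq> cube 0 2"
    proof
      fix w assume "w \<in> cube (- v) 1"
      from cube_trans[OF this, of 0 1] show "w \<in> cube 0 2" using assms by (simp add: cube_uminus)
    qed
  qed
  then show ?thesis by (rule integral_unique)
qed

text \<open>The bump centred at $a$ is also an admissible kernel for every nearby point $y$, so both
  values are compared with one and the same average.\<close>

lemma morrey_oscillation:
  fixes u :: "real^'n \<Rightarrow> real"
  assumes r: "0 < r" and D: "cube a (3 * r) \<subseteq> D" and y: "y \<in> cube a r"
    and u: "continuous_on D u" "\<And>j. weak_partial D j u (g j)"
    and p: "real CARD('n) < p"
    and E: "\<And>j x. x \<in> cube a r \<Longrightarrow> local_energy x (2 * r) p (g j) \<le> ennreal E" "0 \<le> E"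
  shows "\<bar>u y - u a\<bar> * integral (cube 0 1) (bump :: real^'n \<Rightarrow> real)
     \<le> 4 * real CARD('n) * (4 ^ CARD('n) + E) / (1 - real CARD('n) / p) * r powr (1 - real CARD('n) / p)"
proof -
  let ?I = "integral (cube 0 1) (bump :: real^'n \<Rightarrow> real)"
  let ?F = "\<lambda>z. u z * bump ((z - a) /\<^sub>R r)"
  have F0: "?F z = 0" if "z \<notin> cube a r" for z
  proof -
    have "(z - a) /\<^sub>R r \<notin> cube 0 1"
      using that r by (auto simp: mem_cube abs_mult divide_simps abs_minus_commute)
    then show ?thesis by (simp add: bump_outside_cube)
  qed
  have est: "\<bar>integral (cube a (2 * r)) ?F / r ^ CARD('n) - u x * ?I\<bar>
     \<le> 2 * real CARD('n) * (4 ^ CARD('n) + E) / (1 - real CARD('n) / p) * r powr (1 - real CARD('n) / p)"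
    if x: "x \<in> cube a r" for x
  proof -
    \<comment> \<open>Seen from the centre x, the bump centred at a is the kernel w -> bump (w + v)
      at the same scale r.\<close>
    define v where "v = (x - a) /\<^sub>R r"
    have v: "v \<in> cube 0 1"
      using x r by (auto simp: v_def mem_cube abs_mult divide_simps abs_minus_commute)
    have smooth: "smooth_fun (\<lambda>w. bump (w + v))"
      using smooth_fun_affine[OF smooth_bump, of 1 v] by simp
    have supp: "bump (w + v) = 0" if "w \<notin> cube 0 2" for w
    proof (rule bump_outside_cube)
      show "w + v \<notin> cube 0 1"
      proof
        assume "w + v \<in> cube 0 1"
        then have "w \<in> cube (- v) 1" by (simp add: cube_shift)
        from cube_trans[OF this, of 0 1] that v show False by (simp add: cube_uminus)
      qed
    qed
    have sub: "cube x (2 * r) \<subseteq> cube a (3 * r)"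
      using cube_trans[OF _ x, of _ "2 * r"] by auto
    have "x \<in> cube a r \<longleftrightarrow> a \<in> cube x r" by (rule cube_commute)
    then have sub2: "cube a r \<subseteq> cube x (2 * r)"
      using cube_trans[of _ a r x r] x by auto
    have sub3: "cube a r \<subseteq> cube a (2 * r)" using r by (intro cube_mono) simp
    \<comment> \<open>Both cubes contain the support of the integrand, so the two integrals agree
      although the domains differ.\<close>
    have "integral (cube a (2 * r)) ?F = integral UNIV (\<lambda>z. if z \<in> cube a (2 * r) then ?F z else 0)"
      by (rule integral_restrict_UNIV[symmetric])
    also have "\<dots> = integral UNIV (\<lambda>z. if z \<in> cube x (2 * r) then ?F z else 0)"
      by (rule integral_cong) (use F0 sub2 sub3 in auto)
    also have "\<dots> = integral (cube x (2 * r)) ?F" by (rule integral_restrict_UNIV)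
    finally have "integral (cube a (2 * r)) ?F = integral (cube x (2 * r)) ?F" .
    moreover have "?F = (\<lambda>z. u z * bump ((z - x) /\<^sub>R r + v))"
      by (simp add: v_def scaleR_diff_right)
    ultimately have eq: "integral (cube a (2 * r)) ?F = integral (cube x (2 * r)) (\<lambda>z. u z * bump ((z - x) /\<^sub>R r + v))"
      by metis
    have b: "\<bar>bump (w + v)\<bar> \<le> 1" for w
      using bump_bounds[of "w + v"] by simp
    show ?thesis
      unfolding eq integral_bump_shift[OF v, symmetric]
      by (rule morrey_estimate[OF smooth _ b r subset_trans[OF sub D] u p E(1)[OF x] E(2)]) (rule supp)
  qed
  have "a \<in> cube a r" using r by (simp add: mem_cube)
  note est[OF this] est[OF y]
  then have "\<bar>u y * ?I - u a * ?I\<bar>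
     \<le> 2 * (2 * real CARD('n) * (4 ^ CARD('n) + E) / (1 - real CARD('n) / p) * r powr (1 - real CARD('n) / p))"
    by linarith
  moreover have "\<bar>u y * ?I - u a * ?I\<bar> = \<bar>u y - u a\<bar> * ?I"
    using integral_bump_pos[where 'n='n] by (simp add: left_diff_distrib[symmetric] abs_mult)
  ultimately show ?thesis by simp
qed


lemma cube_subset_open:
  fixes a :: "real^'n"
  assumes "open D" "a \<in> D"
  obtains \<rho> where "0 < \<rho>" "cube a \<rho> \<subseteq> D"
proof -
  obtain e where e: "0 < e" "cball a e \<subseteq> D"
    using assms open_contains_cball by blast
  show thesis
  proof
    show "0 < e / real CARD('n)" using e by simp
    have "cube a (e / real CARD('n)) \<subseteq> cball a e"
    proof
      fix z assume "z \<in> cube a (e / real CARD('n))"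
      then have z: "\<bar>(z - a) $ j\<bar> \<le> e / real CARD('n)" for j by (simp add: mem_cube)
      have "norm (z - a) \<le> (\<Sum>j\<in>UNIV. \<bar>(z - a) $ j\<bar>)" by (rule norm_le_l1_cart)
      also have "\<dots> \<le> real CARD('n) * (e / real CARD('n))"
        using sum_bounded_above[of UNIV "\<lambda>j. \<bar>(z - a) $ j\<bar>", OF z] by simp
      finally show "z \<in> cball a e" by (simp add: dist_norm norm_minus_commute)
    qed
    then show "cube a (e / real CARD('n)) \<subseteq> D" using e by blast
  qed
qed

text \<open>The oscillation bound depends on f only through its energy, hence only through M.
  Coordinates are handled one by one, each receiving the share e / \<open>CARD('m)\<close>.\<close>

lemma family_equicontinuous:
  fixes D :: "(real^'n) set" and \<phi> :: "ennreal \<Rightarrow> ennreal"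
  assumes D: "open D" "a \<in> D" and \<phi>: "\<phi> \<in> borel_measurable borel"
    and AB: "0 \<le> A" "0 \<le> B" "\<And>t. 0 \<le> t \<Longrightarrow> ennreal (t powr p) \<le> ennreal A * \<phi> (ennreal t) + ennreal B"
    and p: "real CARD('n) < p" and M: "0 \<le> M" and e: "0 < e"
  obtains d where "0 < d"
    "\<And>f y. (f :: real^'n \<Rightarrow> real^'m) \<in> family_F \<phi> M D x0 \<Longrightarrow> norm (a - y) < d \<Longrightarrow> norm (f a - f y) < e"
proof -
  let ?I = "integral (cube 0 1) (bump :: real^'n \<Rightarrow> real)"
  have I: "0 < ?I" by (rule integral_bump_pos)
  \<comment> \<open>A cube of radius 2r has volume (4r)^n, which is at most 4^n because r will be at
    most 1.\<close>
  define E where "E = A * M + B * 4 ^ CARD('n)"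
  define \<tau> where "\<tau> = 1 - real CARD('n) / p"
  define C where "C = 4 * real CARD('n) * (4 ^ CARD('n) + E) / \<tau>"
  have p0: "0 < p" using p by linarith
  have \<tau>: "0 < \<tau>" using p by (simp add: \<tau>_def)
  have E: "0 \<le> E" using AB M by (simp add: E_def)
  then have C: "0 \<le> C" using \<tau> by (simp add: C_def)
  obtain \<rho> where \<rho>: "0 < \<rho>" "cube a \<rho> \<subseteq> D"
    using D cube_subset_open by blast
  \<comment> \<open>Solves (C + 1) x = (e / \<open>CARD('m)\<close>) ?I, so r^\<tau> \<le> x forces
    the bound C r^\<tau> below the share of one coordinate. The 1 gives strictness and a nonzero
    denominator.\<close>
  define x where "x = e * ?I / (real CARD('m) * (C + 1))"
  have x: "0 < x" using e I C by (simp add: x_def)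
  define r where "r = min (min 1 (\<rho> / 3)) (x powr (1 / \<tau>))"
  have r: "0 < r" "r \<le> 1" "3 * r \<le> \<rho>" using \<rho> x by (auto simp: r_def)
  have "r powr \<tau> \<le> (x powr (1 / \<tau>)) powr \<tau>"
    using r \<tau> by (intro powr_mono2) (auto simp: r_def)
  then have "r powr \<tau> \<le> x" using x \<tau> by (simp add: powr_powr)
  then have "C * r powr \<tau> \<le> C * x" using C by (rule mult_left_mono)
  also have "\<dots> < (C + 1) * x" using x by simp
  also have "\<dots> = e / real CARD('m) * ?I"
  proof -
    have "C + 1 \<noteq> 0" using C by linarith
    then show ?thesis unfolding x_def by (simp add: divide_simps)
  qed
  finally have small: "C * r powr \<tau> < e / real CARD('m) * ?I" .
  have sub: "cube a (3 * r) \<subseteq> D" using \<rho> cube_mono[OF r(3)] by blast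
  show thesis
  proof (rule that[OF r(1)])
    fix f :: "real^'n \<Rightarrow> real^'m" and y
    assume f: "f \<in> family_F \<phi> M D x0" and "norm (a - y) < r"
    then have y: "y \<in> cube a r"
      unfolding mem_cube using component_le_norm_cart[of "a - y"]
      by (auto simp: abs_minus_commute intro: order_trans less_imp_le)
    obtain g where g: "weak_jacobian D f g" "(\<integral>\<^sup>+ x\<in>D. \<phi> (ennreal (grad_norm g x)) \<partial>lebesgue) \<le> ennreal M"
      and cf: "continuous_on D f"
      using f unfolding family_F_def by blast
    have wp: "weak_partial D j (\<lambda>x. f x $ i) (g i j)" for i j
      using g(1) unfolding weak_jacobian_def by blast
    then have lg: "locally_integrable D (g i j)" for i j
      unfolding weak_partial_def by blast
    have en: "local_energy x (2 * r) p (g i j) \<le> ennreal E" if x: "x \<in> cube a r" for x i j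
    proof -
      have "cube x (2 * r) \<subseteq> D" using cube_trans[OF _ x, of _ "2 * r"] sub by auto
      then have "local_energy x (2 * r) p (g i j) \<le> ennreal (A * M + B * (2 * (2 * r)) ^ CARD('n))"
        using r p0 by (intro local_energy_bound[OF D(1) lg \<phi> AB g(2) M]) auto
      also have "\<dots> \<le> ennreal E"
        unfolding E_def using r AB by (intro ennreal_leI add_left_mono mult_left_mono power_mono) auto
      finally show ?thesis .
    qed
    have comp: "\<bar>(f a - f y) $ i\<bar> < e / real CARD('m)" for i
    proof -
      have "continuous_on D (\<lambda>x. f x $ i)" using cf by (rule continuous_on_component)
      from morrey_oscillation[OF r(1) sub y this wp p en E]
      have "\<bar>f y $ i - f a $ i\<bar> * ?I \<le> C * r powr \<tau>"
        by (simp add: C_def \<tau>_def)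
      also note small
      finally have "\<bar>f y $ i - f a $ i\<bar> < e / real CARD('m)"
        using I mult_less_cancel_right_pos by blast
      then show ?thesis by (simp add: abs_minus_commute)
    qed
    have "norm (f a - f y) \<le> (\<Sum>i\<in>UNIV. \<bar>(f a - f y) $ i\<bar>)" by (rule norm_le_l1_cart)
    also have "\<dots> < real CARD('m) * (e / real CARD('m))"
      by (rule sum_bounded_above_strict) (rule comp, simp)
    finally show "norm (f a - f y) < e" by simp
  qed
qed

text \<open>"The differences F k x - F k y are bounded in k" is an equivalence relation, and
  equicontinuity makes its classes open; connectedness leaves a single class, and the common zero at
  x0 turns this into pointwise boundedness. A finite cover then gives bounds on compact sets, as
  Arzela-Ascoli requires on each set of an exhaustion.\<close>

lemma equicontinuous_imp_locally_uniform_subsequence: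
  fixes F :: "nat \<Rightarrow> 'a::euclidean_space \<Rightarrow> 'b::euclidean_space"
  assumes D: "open D" "connected D" and x0: "x0 \<in> D" "\<And>k. F k x0 = 0"
    and equi: "\<And>a e. a \<in> D \<Longrightarrow> 0 < e \<Longrightarrow> \<exists>d>0. \<forall>k y. norm (a - y) < d \<longrightarrow> norm (F k a - F k y) < e"
  shows "\<exists>r g. strict_mono r \<and> (\<forall>K. compact K \<and> K \<subseteq> D \<longrightarrow> uniform_limit K (F \<circ> r) g sequentially)"
proof -
  define R where "R x y \<longleftrightarrow> (\<exists>B. \<forall>k. norm (F k x - F k y) \<le> B)" for x y
  have "R x0 a" if "a \<in> D" for a
  proof (rule connected_equivalence_relation[OF D(2) x0(1) that])
    show "R y x" if "R x y" for x y using that by (simp add: R_def norm_minus_commute)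
    show "R x z" if "R x y" "R y z" for x y z
    proof -
      obtain B B' where "\<And>k. norm (F k x - F k y) \<le> B" "\<And>k. norm (F k y - F k z) \<le> B'"
        using \<open>R x y\<close> \<open>R y z\<close> unfolding R_def by blast
      then have "norm (F k x - F k z) \<le> B + B'" for k
        using norm_triangle_mono[of "F k x - F k y" B "F k y - F k z" B'] by simp
      then show ?thesis unfolding R_def by blast
    qed
    show "\<exists>T. openin (top_of_set D) T \<and> x \<in> T \<and> (\<forall>y\<in>T. R x y)" if x: "x \<in> D" for x
    proof -
      obtain d where d: "0 < d" "\<And>k y. norm (x - y) < d \<Longrightarrow> norm (F k x - F k y) < 1"
        using equi[OF x, of 1] by auto
      have "R x y" if "y \<in> D \<inter> ball x d" for y
        unfolding R_def
      proof (intro exI allI)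
        show "norm (F k x - F k y) \<le> 1" for k
          using that d(2)[of y k] by (simp add: dist_norm)
      qed
      then show ?thesis
        using d(1) x by (intro exI[of _ "D \<inter> ball x d"]) (auto intro: openin_open_Int)
    qed
  qed
  then have bdd: "\<exists>B. \<forall>k. norm (F k a) \<le> B" if "a \<in> D" for a
    using that x0(2) by (simp add: R_def)
  have bddK: "\<exists>B. \<forall>k. \<forall>x\<in>K. norm (F k x) \<le> B" if K: "compact K" "K \<subseteq> D" for K
  proof -
    have "\<exists>d B. 0 < d \<and> (\<forall>k y. norm (a - y) < d \<longrightarrow> norm (F k y) \<le> B)" if a: "a \<in> D" for a
    proof -
      obtain d where d: "0 < d" "\<And>k y. norm (a - y) < d \<Longrightarrow> norm (F k a - F k y) < 1"
        using equi[OF a, of 1] by auto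
      obtain B where B: "\<And>k. norm (F k a) \<le> B" using bdd[OF a] by blast
      have "norm (F k y) \<le> B + 1" if "norm (a - y) < d" for k y
        using d(2)[OF that, of k] B[of k] norm_triangle_ineq2[of "F k y" "F k a"]
        by (simp add: norm_minus_commute)
      then show ?thesis using d(1) by blast
    qed
    then obtain d B where dB: "\<And>a. a \<in> D \<Longrightarrow> 0 < d a"
      "\<And>a k y. a \<in> D \<Longrightarrow> norm (a - y) < d a \<Longrightarrow> norm (F k y) \<le> B a"
      by metis
    have "K \<subseteq> (\<Union>a\<in>K. ball a (d a))" using dB(1) K(2) by force
    then obtain K' where K': "K' \<subseteq> K" "finite K'" "K \<subseteq> (\<Union>a\<in>K'. ball a (d a))"
      using compactE_image[OF K(1), of K "\<lambda>a. ball a (d a)"] by auto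
    \<comment> \<open>The sum over the finite cover stands in for the maximum of the local
      bounds.\<close>
    have "norm (F k x) \<le> (\<Sum>a\<in>K'. \<bar>B a\<bar>)" if x: "x \<in> K" for k x
    proof -
      obtain a where a: "a \<in> K'" "norm (a - x) < d a"
        using K'(3) x by (auto simp: dist_norm)
      then have "norm (F k x) \<le> \<bar>B a\<bar>"
        using dB(2)[of a x k] K' K by force
      also have "\<dots> \<le> (\<Sum>a\<in>K'. \<bar>B a\<bar>)" using a K'(2) by (intro member_le_sum) auto
      finally show ?thesis .
    qed
    then show ?thesis by blast
  qed
  obtain C where C: "\<And>n. compact (C n)" "\<And>n. C n \<subseteq> D" "\<And>n. C n \<subseteq> interior (C (Suc n))"
    "\<Union> (range C) = D" "\<And>K. compact K \<Longrightarrow> K \<subseteq> D \<Longrightarrow> \<exists>N. \<forall>n\<ge>N. K \<subseteq> C n"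
    using open_Union_compact_subsets[OF D(1)] by metis
  define P where "P i r \<longleftrightarrow> (\<exists>g. \<forall>e>0. \<exists>N. \<forall>n\<ge>N. \<forall>x\<in>C i. norm (F (r n) x - g x) < e)" for i and r :: "nat \<Rightarrow> nat"
  obtain k where k: "strict_mono (k :: nat \<Rightarrow> nat)" "\<And>i. P i (id \<circ> k)"
  proof (rule subsequence_diagonalization_lemma[of P id])
    fix i and r :: "nat \<Rightarrow> nat"
    obtain B where B: "\<And>k x. x \<in> C i \<Longrightarrow> norm (F k x) \<le> B" using bddK[OF C(1,2)] by blast
    obtain g l where "strict_mono (l :: nat \<Rightarrow> nat)"
      "\<And>e. 0 < e \<Longrightarrow> \<exists>N. \<forall>n x. n \<ge> N \<and> x \<in> C i \<longrightarrow> norm (F (r (l n)) x - g x) < e"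
    proof (rule Arzela_Ascoli[OF C(1), of i "\<lambda>n. F (r n)" B])
      show "\<exists>d>0. \<forall>n y. y \<in> C i \<and> norm (x - y) < d \<longrightarrow> norm (F (r n) x - F (r n) y) < e"
        if "x \<in> C i" "0 < e" for x e
        using equi[of x e] that C(2) by blast
    qed (use B in auto)
    then show "\<exists>k. strict_mono k \<and> P i (r \<circ> k)"
      unfolding P_def by (intro exI[of _ l]) (auto, meson)
  next
    fix i N and r k1 k2 :: "nat \<Rightarrow> nat"
    \<comment> \<open>\<open>k2\<close> runs through values of \<open>k1\<close> from index N on
      only; uniform convergence does not see the earlier terms.\<close>
    assume "P i (r \<circ> k1)" and sub: "\<And>j. N \<le> j \<Longrightarrow> \<exists>j'\<ge>j. k2 j = k1 j'"
    then obtain g where g: "\<And>e. 0 < e \<Longrightarrow> \<exists>N. \<forall>n\<ge>N. \<forall>x\<in>C i. norm (F (r (k1 n)) x - g x) < e"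
      unfolding P_def by auto
    have "\<exists>N. \<forall>n\<ge>N. \<forall>x\<in>C i. norm (F (r (k2 n)) x - g x) < e" if e: "0 < e" for e
    proof -
      obtain N' where N': "\<forall>n\<ge>N'. \<forall>x\<in>C i. norm (F (r (k1 n)) x - g x) < e" using g[OF e] by blast
      have "\<forall>x\<in>C i. norm (F (r (k2 n)) x - g x) < e" if "max N N' \<le> n" for n
        using sub[of n] N' that by (metis max.bounded_iff order_trans)
      then show ?thesis by blast
    qed
    then show "P i (r \<circ> k2)" unfolding P_def by auto
  qed auto
  then obtain G where G: "\<And>i e. 0 < e \<Longrightarrow> \<exists>N. \<forall>n\<ge>N. \<forall>x\<in>C i. norm (F (k n) x - G i x) < e"
    unfolding P_def by (simp, metis)
  have lim: "(\<lambda>n. F (k n) x) \<longlonglongrightarrow> G i x" if "x \<in> C i" for i x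
    unfolding LIMSEQ_iff
  proof (intro allI impI)
    fix e :: real assume "0 < e"
    from G[OF this, of i] that show "\<exists>N. \<forall>n\<ge>N. norm (F (k n) x - G i x) < e" by blast
  qed
  \<comment> \<open>The limits on the single sets C i come from separate choices. Uniqueness of
    pointwise limits makes them agree on overlaps, so \<open>lim\<close> glues them into one
    function.\<close>
  define g where "g x = lim (\<lambda>n. F (k n) x)" for x
  have g: "g x = G i x" if "x \<in> C i" for i x
    unfolding g_def using lim[OF that] by (rule limI)
  have "uniform_limit K (F \<circ> k) g sequentially" if K: "compact K" "K \<subseteq> D" for K
  proof (rule uniform_limitI)
    fix e :: real assume e: "0 < e"
    obtain i where i: "K \<subseteq> C i" using C(5)[OF K] by blast
    obtain N where "\<forall>n\<ge>N. \<forall>x\<in>C i. norm (F (k n) x - G i x) < e" using G[OF e] by blast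
    then show "\<forall>\<^sub>F n in sequentially. \<forall>x\<in>K. dist ((F \<circ> k) n x) (g x) < e"
      using i g by (auto simp: eventually_sequentially dist_norm subset_iff intro!: exI[of _ N])
  qed
  with k(1) show ?thesis by blast
qed

section \<open>Minimizing sequences and weak derivatives\<close>

lemma fatou_le:
  fixes u :: "nat \<Rightarrow> 'a \<Rightarrow> ennreal"
  assumes meas: "\<And>n. u n \<in> borel_measurable M"
    and lim: "AE x in M. (\<lambda>n. u n x) \<longlonglongrightarrow> v x"
    and le: "eventually (\<lambda>n. (\<integral>\<^sup>+x. u n x \<partial>M) \<le> c) sequentially"
  shows "(\<integral>\<^sup>+x. v x \<partial>M) \<le> c"
proof -
  have "(\<integral>\<^sup>+x. v x \<partial>M) = (\<integral>\<^sup>+x. liminf (\<lambda>n. u n x) \<partial>M)"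
    by (rule nn_integral_cong_AE) (use lim in \<open>auto elim!: eventually_mono simp: lim_imp_Liminf\<close>)
  also have "\<dots> \<le> liminf (\<lambda>n. \<integral>\<^sup>+x. u n x \<partial>M)"
    by (rule nn_integral_liminf[OF meas])
  also have "\<dots> \<le> limsup (\<lambda>n. \<integral>\<^sup>+x. u n x \<partial>M)"
    by (rule Liminf_le_Limsup) simp
  also have "\<dots> \<le> c" using le by (rule Limsup_bounded)
  finally show ?thesis .
qed

lemma parallelogram_midpoint:
  fixes x y :: "'a::real_inner"
  shows "(norm (x - y))\<^sup>2 + 4 * (norm ((1/2) *\<^sub>R (x + y)))\<^sup>2 = 2 * (norm x)\<^sup>2 + 2 * (norm y)\<^sup>2"
  by (simp add: power2_norm_eq_inner inner_diff_left inner_diff_right inner_add_left inner_add_right inner_commute algebra_simps)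

text \<open>Summable distances between consecutive terms make the telescoping series absolutely
  convergent almost everywhere. Fatou's lemma in l, with k fixed, carries the Cauchy estimate over
  to the limit.\<close>

lemma fast_cauchy_L1_convergence:
  fixes G :: "nat \<Rightarrow> 'a \<Rightarrow> 'b::euclidean_space"
  assumes meas: "\<And>k. G k \<in> borel_measurable M"
    and c: "summable c" "\<And>k. 0 \<le> c k"
    and le: "\<And>k l. k \<le> l \<Longrightarrow> (\<integral>\<^sup>+x. ennreal (norm (G k x - G l x)) \<partial>M) \<le> ennreal (c k)"
  obtains L where "L \<in> borel_measurable M" "AE x in M. (\<lambda>k. G k x) \<longlonglongrightarrow> L x"
    "(\<lambda>k. \<integral>\<^sup>+x. ennreal (norm (G k x - L x)) \<partial>M) \<longlonglongrightarrow> 0"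
proof
  note [measurable] = meas
  let ?L = "\<lambda>x. lim (\<lambda>k. G k x)"
  show L: "?L \<in> borel_measurable M" by measurable
  have "(\<integral>\<^sup>+x. (\<Sum>k. ennreal (norm (G k x - G (Suc k) x))) \<partial>M)
      = (\<Sum>k. \<integral>\<^sup>+x. ennreal (norm (G k x - G (Suc k) x)) \<partial>M)"
    by (rule nn_integral_suminf) measurable
  also have "\<dots> \<le> (\<Sum>k. ennreal (c k))"
    by (intro suminf_le le) auto
  also have "\<dots> < \<infinity>" using c by (simp add: suminf_ennreal2)
  finally have "(\<integral>\<^sup>+x. (\<Sum>k. ennreal (norm (G k x - G (Suc k) x))) \<partial>M) \<noteq> \<infinity>" by simp
  then have "AE x in M. (\<Sum>k. ennreal (norm (G k x - G (Suc k) x))) \<noteq> \<infinity>"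
    by (rule nn_integral_PInf_AE[rotated]) measurable
  then show lim: "AE x in M. (\<lambda>k. G k x) \<longlonglongrightarrow> ?L x"
  proof (rule AE_mp, intro AE_I2 impI)
    fix x assume "(\<Sum>k. ennreal (norm (G k x - G (Suc k) x))) \<noteq> \<infinity>"
    then have "summable (\<lambda>k. norm (G k x - G (Suc k) x))"
      by (intro summable_suminf_not_top) auto
    then have "summable (\<lambda>k. norm (G (Suc k) x - G k x))"
      by (simp add: norm_minus_commute)
    then have "summable (\<lambda>k. G (Suc k) x - G k x)"
      by (rule summable_norm_cancel)
    then have "convergent (\<lambda>n. \<Sum>k<n. G (Suc k) x - G k x)"
      by (simp add: summable_iff_convergent)
    then have "convergent (\<lambda>n. G n x - G 0 x)"
      by (simp add: sum_lessThan_telescope[of "\<lambda>k. G k x"])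
    then have "convergent (\<lambda>n. (G n x - G 0 x) + G 0 x)"
      by (rule convergent_add[OF _ convergent_const])
    then show "(\<lambda>k. G k x) \<longlonglongrightarrow> ?L x" by (simp add: convergent_LIMSEQ_iff)
  qed
  have bound: "(\<integral>\<^sup>+x. ennreal (norm (G k x - ?L x)) \<partial>M) \<le> ennreal (c k)" for k
  proof (rule fatou_le)
    show "AE x in M. (\<lambda>l. ennreal (norm (G k x - G l x))) \<longlonglongrightarrow> ennreal (norm (G k x - ?L x))"
      using lim by eventually_elim (intro tendsto_intros)
    show "\<forall>\<^sub>F l in sequentially. (\<integral>\<^sup>+x. ennreal (norm (G k x - G l x)) \<partial>M) \<le> ennreal (c k)"
      using le eventually_sequentially by blast
  qed measurable
  have "(\<lambda>k. ennreal (c k)) \<longlonglongrightarrow> ennreal 0"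
    using summable_LIMSEQ_zero[OF c(1)] by (rule tendsto_ennrealI)
  then have c0: "(\<lambda>k. ennreal (c k)) \<longlonglongrightarrow> 0" by simp
  show "(\<lambda>k. \<integral>\<^sup>+x. ennreal (norm (G k x - ?L x)) \<partial>M) \<longlonglongrightarrow> 0"
    by (rule tendsto_sandwich[OF always_eventually always_eventually tendsto_const c0]) (simp_all add: bound)
qed

text \<open>A Banach--Saks substitute for weak compactness: almost minimal elements of a decreasing
  sequence of midpoint-convex sets that is bounded in $L^2$ form a Cauchy sequence, by the
  parallelogram law.\<close>

lemma minimizing_sequence_convergence:
  fixes S :: "nat \<Rightarrow> ('a \<Rightarrow> 'b::euclidean_space) set"
  assumes fin: "finite_measure M"
    and meas: "\<And>N G. G \<in> S N \<Longrightarrow> G \<in> borel_measurable M"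
    and anti: "\<And>N N'. N \<le> N' \<Longrightarrow> S N' \<subseteq> S N"
    and ne: "\<And>N. S N \<noteq> {}"
    and mid: "\<And>N G H. G \<in> S N \<Longrightarrow> H \<in> S N \<Longrightarrow> (\<lambda>x. (1/2) *\<^sub>R (G x + H x)) \<in> S N"
    and bdd: "\<And>N G. G \<in> S N \<Longrightarrow> (\<integral>\<^sup>+x. ennreal ((norm (G x))\<^sup>2) \<partial>M) \<le> ennreal B"
  obtains G L where "\<And>k. G k \<in> S k" "L \<in> borel_measurable M"
    "AE x in M. (\<lambda>k. G k x) \<longlonglongrightarrow> L x"
    "(\<lambda>k. \<integral>\<^sup>+x. ennreal (norm (G k x - L x)) \<partial>M) \<longlonglongrightarrow> 0"
proof -
  interpret finite_measure M by fact
  define Q where "Q G = (\<integral>\<^sup>+x. ennreal ((norm (G x))\<^sup>2) \<partial>M)" for G :: "'a \<Rightarrow> 'b"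
  define q where "q G = enn2real (Q G)" for G
  define m where "m = measure M (space M)"
  have Qq: "Q G = ennreal (q G)" if "G \<in> S N" for G N
  proof -
    have "Q G < \<infinity>" using bdd[OF that] by (auto simp: Q_def le_less_trans)
    then show ?thesis by (simp add: q_def)
  qed
  have q0: "0 \<le> q G" for G by (simp add: q_def)
  have qB: "q G \<le> \<bar>B\<bar>" if "G \<in> S N" for G N
  proof -
    have "ennreal (q G) \<le> ennreal \<bar>B\<bar>"
      using bdd[OF that] Qq[OF that] unfolding Q_def by (metis abs_ge_self ennreal_leI order_trans)
    then show ?thesis by simp
  qed
  \<comment> \<open>The infima increase with N because the sets shrink, and they stay below |B|;
    \<open>d'\<close> is their limit.\<close>
  define d where "d N = Inf (q ` S N)" for N
  have d_le: "d N \<le> q G" if "G \<in> S N" for G N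
    unfolding d_def using that q0 by (intro cInf_lower bdd_belowI[of _ 0]) auto
  have dB: "d N \<le> \<bar>B\<bar>" for N
    using ne[of N] d_le qB by (meson ex_in_conv order_trans)
  define d' where "d' = (SUP N. d N)"
  have d': "d N \<le> d'" for N
    unfolding d'_def using dB by (intro cSUP_upper bdd_aboveI2) auto
  \<comment> \<open>The rate is fixed by the passage from L^2 to L^1: Young's inequality at
    threshold 4^(-k) multiplies the squared distance 8 \<epsilon> k by 4^k, and 16^(-k) leaves the
    summable 8 * 4^(-k).\<close>
  define \<epsilon> where "\<epsilon> k = (1 / 16 :: real) ^ k" for k
  have \<epsilon>: "0 < \<epsilon> k" for k by (simp add: \<epsilon>_def)
  have "\<exists>N\<ge>k. d' - \<epsilon> k \<le> d N" for k
  proof -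
    have "d' - \<epsilon> k < (SUP N. d N)" using \<epsilon>[of k] by (simp add: d'_def)
    then obtain N where N: "d' - \<epsilon> k < d N"
      using less_cSUP_iff[of UNIV d] dB by (metis UNIV_not_empty bdd_aboveI2 UNIV_I)
    have "S (max k N) \<subseteq> S N" by (rule anti) simp
    then have "d N \<le> d (max k N)"
      unfolding d_def using ne q0 by (intro cInf_superset_mono image_mono) (auto intro!: bdd_belowI[of _ 0])
    with N show ?thesis by (intro exI[of _ "max k N"]) auto
  qed
  then obtain N where N: "\<And>k. k \<le> N k" "\<And>k. d' - \<epsilon> k \<le> d (N k)" by metis
  have "\<exists>G\<in>S (N k). q G < d (N k) + \<epsilon> k" for k
  proof -
    have "Inf (q ` S (N k)) < d (N k) + \<epsilon> k" using \<epsilon> by (simp add: d_def)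
    then show ?thesis using ne cInf_lessD[of "q ` S (N k)"] by blast
  qed
  then obtain G where G: "\<And>k. G k \<in> S (N k)" "\<And>k. q (G k) < d (N k) + \<epsilon> k" by metis
  have Gm[measurable]: "G k \<in> borel_measurable M" for k using G(1) meas by blast
  define c where "c k = (m + 8) * (1 / 4) ^ k" for k
  have L1: "(\<integral>\<^sup>+x. ennreal (norm (G k x - G l x)) \<partial>M) \<le> ennreal (c k)" if "k \<le> l" for k l
  proof -
    \<comment> \<open>The midpoint must lie in a set containing both terms, so n is the smaller of
      \<open>N k\<close> and \<open>N l\<close>. In either case the infimum at n is within
      \<epsilon> k of \<open>d'\<close>.\<close>
    obtain n where n: "G k \<in> S n" "G l \<in> S n" "d' - \<epsilon> k \<le> d n"
    proof (cases "N k \<le> N l")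
      case True
      then show thesis using that[of "N k"] G(1) N(2) anti by blast
    next
      case False
      have "\<epsilon> l \<le> \<epsilon> k" unfolding \<epsilon>_def using \<open>k \<le> l\<close> by (intro power_decreasing) auto
      then have "d' - \<epsilon> k \<le> d (N l)" using N(2)[of l] by linarith
      then show thesis using that[of "N l"] G(1) False anti[of "N l" "N k"] by auto
    qed
    let ?H = "\<lambda>x. (1/2) *\<^sub>R (G k x + G l x)"
    have H: "?H \<in> S n" using mid n by blast
    have Hm[measurable]: "?H \<in> borel_measurable M" using H meas by blast
    have "Q (\<lambda>x. G k x - G l x) + 4 * Q ?H
       = (\<integral>\<^sup>+x. ennreal ((norm (G k x - G l x))\<^sup>2) + 4 * ennreal ((norm (?H x))\<^sup>2) \<partial>M)"
      unfolding Q_def by (subst nn_integral_add) (auto simp: nn_integral_cmult)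
    also have "\<dots> = (\<integral>\<^sup>+x. 2 * ennreal ((norm (G k x))\<^sup>2) + 2 * ennreal ((norm (G l x))\<^sup>2) \<partial>M)"
    proof (rule nn_integral_cong)
      fix x
      have "ennreal ((norm (G k x - G l x))\<^sup>2 + 4 * (norm (?H x))\<^sup>2)
          = ennreal (2 * (norm (G k x))\<^sup>2 + 2 * (norm (G l x))\<^sup>2)"
        by (rule arg_cong[OF parallelogram_midpoint])
      then show "ennreal ((norm (G k x - G l x))\<^sup>2) + 4 * ennreal ((norm (?H x))\<^sup>2)
          = 2 * ennreal ((norm (G k x))\<^sup>2) + 2 * ennreal ((norm (G l x))\<^sup>2)"
        by (simp only: ennreal_plus ennreal_mult zero_le_power2 zero_le_numeral mult_nonneg_nonneg ennreal_numeral)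
    qed
    also have "\<dots> = 2 * Q (G k) + 2 * Q (G l)"
      unfolding Q_def by (subst nn_integral_add) (auto simp: nn_integral_cmult)
    finally have sum: "Q (\<lambda>x. G k x - G l x) + 4 * Q ?H = 2 * Q (G k) + 2 * Q (G l)" .
    have "Q (\<lambda>x. G k x - G l x) \<le> 2 * Q (G k) + 2 * Q (G l)"
      unfolding sum[symmetric] by simp
    also have "\<dots> = ennreal (2 * q (G k) + 2 * q (G l))"
      using q0 by (simp add: Qq[OF G(1)] ennreal_mult)
    finally have "Q (\<lambda>x. G k x - G l x) < \<infinity>" by (rule le_less_trans) simp
    then have QD: "Q (\<lambda>x. G k x - G l x) = ennreal (q (\<lambda>x. G k x - G l x))"
      by (simp add: q_def)
    have "ennreal (q (\<lambda>x. G k x - G l x) + 4 * q ?H) = ennreal (2 * q (G k) + 2 * q (G l))"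
      using sum q0 by (simp add: QD Qq[OF H] Qq[OF G(1)] ennreal_mult)
    then have "q (\<lambda>x. G k x - G l x) + 4 * q ?H = 2 * q (G k) + 2 * q (G l)"
      using q0 by (subst (asm) ennreal_inj) auto
    moreover have "q (G k) \<le> d' + \<epsilon> k" using G(2)[of k] d'[of "N k"] by linarith
    moreover have "q (G l) \<le> d' + \<epsilon> k"
    proof -
      have "\<epsilon> l \<le> \<epsilon> k" unfolding \<epsilon>_def using \<open>k \<le> l\<close> by (intro power_decreasing) auto
      then show ?thesis using G(2)[of l] d'[of "N l"] by linarith
    qed
    moreover have "d' - \<epsilon> k \<le> q ?H" using n(3) d_le[OF H] by linarith
    \<comment> \<open>The parallelogram law gives at most 4 (d' + \<epsilon> k) - 4 (d' - \<epsilon>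
      k).\<close>
    ultimately have qD: "q (\<lambda>x. G k x - G l x) \<le> 8 * \<epsilon> k" by linarith
    have "(\<integral>\<^sup>+x. ennreal (norm (G k x - G l x)) \<partial>M)
       \<le> (\<integral>\<^sup>+x. ennreal ((1 / 4) ^ k) + ennreal (4 ^ k) * ennreal ((norm (G k x - G l x))\<^sup>2) \<partial>M)"
    proof (rule nn_integral_mono)
      fix x
      have "a \<le> (1 / 4) ^ k + 4 ^ k * a\<^sup>2" if "0 \<le> a" for a :: real
        using young_powr[of a "(1 / 4) ^ k" 2] that by (simp add: powr_minus power_divide powr_numeral)
      from this[of "norm (G k x - G l x)"]
      have "ennreal (norm (G k x - G l x)) \<le> ennreal ((1 / 4) ^ k + 4 ^ k * (norm (G k x - G l x))\<^sup>2)"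
        by (intro ennreal_leI) auto
      then show "ennreal (norm (G k x - G l x)) \<le> ennreal ((1 / 4) ^ k) + ennreal (4 ^ k) * ennreal ((norm (G k x - G l x))\<^sup>2)"
        by (simp add: ennreal_plus ennreal_mult)
    qed
    also have "\<dots> = ennreal ((1 / 4) ^ k) * emeasure M (space M) + ennreal (4 ^ k) * Q (\<lambda>x. G k x - G l x)"
      unfolding Q_def by (subst nn_integral_add) (auto simp: nn_integral_cmult)
    also have "\<dots> = ennreal ((1 / 4) ^ k * m + 4 ^ k * q (\<lambda>x. G k x - G l x))"
      unfolding QD m_def emeasure_eq_measure using q0 by (simp add: ennreal_mult ennreal_plus)
    also have "\<dots> \<le> ennreal ((1 / 4) ^ k * m + 4 ^ k * (8 * \<epsilon> k))"
      using qD by (intro ennreal_leI add_left_mono mult_left_mono) auto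
    also have "(1 / 4) ^ k * m + 4 ^ k * (8 * \<epsilon> k) = c k"
    proof -
      have "4 ^ k * \<epsilon> k = (1 / 4 :: real) ^ k"
        unfolding \<epsilon>_def by (simp add: power_mult_distrib[symmetric])
      then show ?thesis by (simp add: c_def algebra_simps)
    qed
    finally show ?thesis .
  qed
  have "summable c" unfolding c_def by (intro summable_mult summable_geometric) simp
  moreover have "0 \<le> c k" for k by (simp add: c_def m_def)
  ultimately show thesis
  proof (rule fast_cauchy_L1_convergence[OF Gm _ _ L1])
    fix L assume "L \<in> borel_measurable M" "AE x in M. (\<lambda>k. G k x) \<longlonglongrightarrow> L x"
      "(\<lambda>k. \<integral>\<^sup>+x. ennreal (norm (G k x - L x)) \<partial>M) \<longlonglongrightarrow> 0"
    moreover have "G k \<in> S k" for k using G(1)[of k] anti[OF N(1)[of k]] by blast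
    ultimately show thesis by (intro that)
  qed
qed


text \<open>The coefficients combine 2^(-k-1), whose sum is 1, with division by 1 + |C k|, which
  keeps every term of the integral below 2^(-k-1). The bound by the indicator of D lets the weighted
  energy be compared with the energy; the lower bounds on C N let weighted convergence descend to
  compact sets.\<close>

lemma exhaustion_weight:
  fixes C :: "nat \<Rightarrow> (real^'n) set"
  assumes C: "\<And>n. compact (C n)" "\<Union> (range C) = D"
  obtains w where "w \<in> borel_measurable lebesgue" "\<And>x. w x \<le> indicator D x"
    "(\<integral>\<^sup>+x. w x \<partial>lebesgue) \<le> 1" "\<And>x. x \<in> D \<Longrightarrow> 0 < w x"
    "\<And>N. \<exists>c>0. \<forall>x\<in>C N. ennreal c \<le> w x"
proof
  define a where "a k = (1 / 2) ^ Suc k / (1 + measure lebesgue (C k))" for k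
  define w where "w x = (\<Sum>k. ennreal (a k) * indicator (C k) x)" for x
  have pos: "0 < 1 + measure lebesgue (C k)" for k
    by (simp add: add_pos_nonneg)
  then have a: "0 < a k" for k unfolding a_def by (intro divide_pos_pos) auto
  have ah: "a k \<le> (1 / 2) ^ Suc k" for k
    using pos[of k] by (simp add: a_def divide_le_eq mult_left_le)
  have half: "(\<Sum>k. ennreal ((1 / 2) ^ Suc k)) = 1"
  proof -
    have "(\<Sum>k. ennreal ((1 / 2) ^ Suc k)) = ennreal 1"
      by (rule suminf_ennreal_eq[OF _ power_half_series]) (rule zero_le_power, simp)
    then show ?thesis by (simp only: ennreal_1)
  qed
  have Cs: "C k \<in> sets lebesgue" for k
    using C(1) by (simp add: borel_compact)
  show "w \<in> borel_measurable lebesgue"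
    unfolding w_def using Cs by measurable
  show "w x \<le> indicator D x" for x
  proof (cases "x \<in> D")
    case True
    have "w x \<le> (\<Sum>k. ennreal ((1 / 2) ^ Suc k))"
      unfolding w_def using ah by (intro suminf_le) (auto simp: indicator_def intro!: ennreal_leI)
    then show ?thesis using True by (simp only: half indicator_simps)
  next
    case False
    then have "x \<notin> C k" for k using C(2) by blast
    then show ?thesis by (simp add: w_def)
  qed
  have le: "ennreal (a N) \<le> w x" if "x \<in> C N" for N x
  proof -
    have "ennreal (a N) = (\<Sum>k\<in>{N}. ennreal (a k) * indicator (C k) x)" using that by simp
    also have "\<dots> \<le> w x" unfolding w_def by (rule sum_le_suminf) auto
    finally show ?thesis .
  qed
  show "0 < w x" if x: "x \<in> D" for x
  proof -
    obtain k where "x \<in> C k" using x C(2) by blast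
    then show ?thesis using le a[of k] by (metis ennreal_less_zero_iff order_less_le_trans)
  qed
  show "\<exists>c>0. \<forall>x\<in>C N. ennreal c \<le> w x" for N
    using le a by blast
  have "(\<integral>\<^sup>+x. w x \<partial>lebesgue) = (\<Sum>k. ennreal (a k) * emeasure lebesgue (C k))"
    unfolding w_def using Cs by (subst nn_integral_suminf) (auto simp: nn_integral_cmult)
  also have "\<dots> \<le> (\<Sum>k. ennreal ((1 / 2) ^ Suc k))"
  proof (rule suminf_le)
    fix k
    have "emeasure lebesgue (C k) = ennreal (measure lebesgue (C k))"
      using C(1) by (intro emeasure_eq_measure2 lmeasurable_compact)
    then have "ennreal (a k) * emeasure lebesgue (C k) = ennreal (a k * measure lebesgue (C k))"
      using a[of k] by (simp add: ennreal_mult less_imp_le)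
    also have "a k * measure lebesgue (C k) \<le> (1 / 2) ^ Suc k"
      using pos[of k] by (simp add: a_def divide_le_eq mult_left_mono)
    finally show "ennreal (a k) * emeasure lebesgue (C k) \<le> ennreal ((1 / 2) ^ Suc k)"
      by (simp add: ennreal_leI)
  qed auto
  finally show "(\<integral>\<^sup>+x. w x \<partial>lebesgue) \<le> 1" by (simp only: half)
qed

lemma grad_norm_matrix: "grad_norm (\<lambda>i j x. G x $ i $ j) x = norm (G x)"
  for G :: "real^'n \<Rightarrow> real^'n^'m"
  by (simp add: grad_norm_def norm_vec_def L2_set_def sum_nonneg)

section \<open>Weak derivatives under change of representative, midpoints and L^1 limits\<close>

lemma locally_integrable_cong:
  assumes "locally_integrable D u" "\<And>x. x \<in> D \<Longrightarrow> u x = v x"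
  shows "locally_integrable D v"
  unfolding locally_integrable_def
proof (intro allI impI)
  fix K assume K: "compact K \<and> K \<subseteq> D"
  then have "set_integrable lebesgue K u" using assms(1) unfolding locally_integrable_def by blast
  then show "set_integrable lebesgue K v"
    by (rule set_integrable_cong[THEN iffD1, rotated -1]) (use K assms(2) in auto)
qed

text \<open>Allows a weak derivative to be replaced by its extension by zero outside D, which is
  measurable on the whole space.\<close>

lemma weak_partial_cong:
  fixes D :: "(real^'n) set"
  assumes "open D" "weak_partial D j u g" "\<And>x. x \<in> D \<Longrightarrow> g x = h x"
  shows "weak_partial D j u h"
proof -
  have D: "D \<in> sets lebesgue" using assms(1) by (simp add: borel_open)
  have "(LINT x:D|lebesgue. g x * \<psi> x) = (LINT x:D|lebesgue. h x * \<psi> x)" for \<psi>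
    by (rule set_lebesgue_integral_cong[OF D]) (simp add: assms(3))
  moreover have "locally_integrable D h"
    using locally_integrable_cong[of D g h] assms(2,3) unfolding weak_partial_def by blast
  ultimately show ?thesis
    using assms(2) unfolding weak_partial_def by simp
qed

lemma test_fun_supports:
  fixes \<psi> :: "real^'n \<Rightarrow> real"
  assumes "test_fun D \<psi>"
  obtains K where "compact K" "K \<subseteq> D" "continuous_on UNIV \<psi>" "\<And>x. x \<notin> K \<Longrightarrow> \<psi> x = 0"
    "continuous_on UNIV (\<lambda>x. frechet_derivative \<psi> (at x) v)"
    "\<And>x. x \<notin> K \<Longrightarrow> frechet_derivative \<psi> (at x) v = 0"
proof
  show "compact (closure {x. \<psi> x \<noteq> 0})" "closure {x. \<psi> x \<noteq> 0} \<subseteq> D"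
    using assms unfolding test_fun_def by auto
  have s: "smooth_fun \<psi>" using assms unfolding test_fun_def by auto
  show "continuous_on UNIV \<psi>" by (rule smooth_fun_continuous[OF s])
  show "continuous_on UNIV (\<lambda>x. frechet_derivative \<psi> (at x) v)" by (rule smooth_fun_has_derivative(2)[OF s])
  show "\<psi> x = 0" if "x \<notin> closure {x. \<psi> x \<noteq> 0}" for x
    using that closure_subset[of "{x. \<psi> x \<noteq> 0}"] by auto
  show "frechet_derivative \<psi> (at x) v = 0" if "x \<notin> closure {x. \<psi> x \<noteq> 0}" for x
    by (rule frechet_derivative_outside_support[OF that])
qed

lemma locally_integrable_midpoint:
  assumes "locally_integrable D u" "locally_integrable D v"
  shows "locally_integrable D (\<lambda>x. (1/2) * (u x + v x))"
  using assms unfolding locally_integrable_def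
  by (auto intro!: set_integral_add set_integrable_mult_right)

lemma weak_partial_midpoint:
  fixes D :: "(real^'n) set"
  assumes u: "weak_partial D j u g" and v: "weak_partial D j v h"
  shows "weak_partial D j (\<lambda>x. (1/2) * (u x + v x)) (\<lambda>x. (1/2) * (g x + h x))"
proof -
  have loc: "locally_integrable D u" "locally_integrable D g" "locally_integrable D v" "locally_integrable D h"
    using u v unfolding weak_partial_def by auto
  have lin: "(LINT x:D|lebesgue. (1/2) * (f1 x + f2 x) * \<theta> x)
      = (1/2) * ((LINT x:D|lebesgue. f1 x * \<theta> x) + (LINT x:D|lebesgue. f2 x * \<theta> x))"
    if "locally_integrable D f1" "locally_integrable D f2" and K: "compact K" "K \<subseteq> D"
      and \<theta>: "continuous_on UNIV \<theta>" "\<And>x. x \<notin> K \<Longrightarrow> \<theta> x = 0" for f1 f2 \<theta> K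
  proof -
    have "set_integrable lebesgue K f1" "set_integrable lebesgue K f2"
      using that unfolding locally_integrable_def by blast+
    then have i: "set_integrable lebesgue D (\<lambda>x. f1 x * \<theta> x)" "set_integrable lebesgue D (\<lambda>x. f2 x * \<theta> x)"
      by (auto intro!: integrable_mult_compact_support(1)[OF _ K \<theta>])
    have "(LINT x:D|lebesgue. (1/2) * (f1 x + f2 x) * \<theta> x)
       = (LINT x:D|lebesgue. (1/2) * (f1 x * \<theta> x + f2 x * \<theta> x))"
      by (simp only: mult.assoc distrib_right)
    also have "\<dots> = (1/2) * (LINT x:D|lebesgue. f1 x * \<theta> x + f2 x * \<theta> x)"
      by (rule set_integral_mult_right)
    also have "(LINT x:D|lebesgue. f1 x * \<theta> x + f2 x * \<theta> x)
       = (LINT x:D|lebesgue. f1 x * \<theta> x) + (LINT x:D|lebesgue. f2 x * \<theta> x)"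
      by (rule set_integral_add(2)[OF i])
    finally show ?thesis .
  qed
  show ?thesis
    unfolding weak_partial_def
  proof (intro conjI allI impI locally_integrable_midpoint loc)
    fix \<psi> assume t: "test_fun D \<psi>"
    obtain K where K: "compact K" "K \<subseteq> D" "continuous_on UNIV \<psi>" "\<And>x. x \<notin> K \<Longrightarrow> \<psi> x = 0"
      "continuous_on UNIV (\<lambda>x. frechet_derivative \<psi> (at x) (axis j 1))"
      "\<And>x. x \<notin> K \<Longrightarrow> frechet_derivative \<psi> (at x) (axis j 1) = 0"
      using test_fun_supports[OF t, of "axis j 1"] by blast
    have "(LINT x:D|lebesgue. (1/2) * (u x + v x) * frechet_derivative \<psi> (at x) (axis j 1))
       = (1/2) * ((LINT x:D|lebesgue. u x * frechet_derivative \<psi> (at x) (axis j 1))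
            + (LINT x:D|lebesgue. v x * frechet_derivative \<psi> (at x) (axis j 1)))"
      by (rule lin[OF loc(1,3) K(1,2,5,6)])
    also have "\<dots> = - ((1/2) * ((LINT x:D|lebesgue. g x * \<psi> x) + (LINT x:D|lebesgue. h x * \<psi> x)))"
    proof -
      have "(LINT x:D|lebesgue. u x * frechet_derivative \<psi> (at x) (axis j 1)) = - (LINT x:D|lebesgue. g x * \<psi> x)"
        "(LINT x:D|lebesgue. v x * frechet_derivative \<psi> (at x) (axis j 1)) = - (LINT x:D|lebesgue. h x * \<psi> x)"
        using u v t unfolding weak_partial_def by blast+
      moreover have "(1/2) * (- a + - b) = - ((1/2) * (a + b))" for a b :: real
        by (simp only: minus_add_distrib[symmetric] mult_minus_right)
      ultimately show ?thesis by metis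
    qed
    also have "\<dots> = - (LINT x:D|lebesgue. (1/2) * (g x + h x) * \<psi> x)"
      by (rule arg_cong[OF lin[OF loc(2,4) K(1-4), symmetric]])
    finally show "(LINT x:D|lebesgue. (1/2) * (u x + v x) * frechet_derivative \<psi> (at x) (axis j 1))
       = - (LINT x:D|lebesgue. (1/2) * (g x + h x) * \<psi> x)" .
  qed
qed

text \<open>A continuous \<psi> is bounded on K, so L^1 convergence on K alone suffices. It serves
  both sides of the weak derivative identity, with \<psi> the test function or one of its partial
  derivatives.\<close>

lemma tendsto_LINT_mult:
  fixes v :: "nat \<Rightarrow> real^'n \<Rightarrow> real"
  assumes v: "\<And>n. locally_integrable D (v n)" and u: "locally_integrable D u"
    and K: "compact K" "K \<subseteq> D"
    and \<psi>: "continuous_on UNIV \<psi>" "\<And>x. x \<notin> K \<Longrightarrow> \<psi> x = 0"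
    and lim: "(\<lambda>n. \<integral>\<^sup>+x\<in>K. ennreal \<bar>v n x - u x\<bar> \<partial>lebesgue) \<longlonglongrightarrow> 0"
  shows "(\<lambda>n. LINT x:D|lebesgue. v n x * \<psi> x) \<longlonglongrightarrow> (LINT x:D|lebesgue. u x * \<psi> x)"
proof -
  have i: "set_integrable lebesgue K (v n)" "set_integrable lebesgue K u" for n
    using u v K unfolding locally_integrable_def by blast+
  have int: "set_integrable lebesgue D (\<lambda>x. v n x * \<psi> x)" for n
    by (rule integrable_mult_compact_support(1)[OF i(1) K \<psi>])
  have int': "set_integrable lebesgue D (\<lambda>x. u x * \<psi> x)"
    by (rule integrable_mult_compact_support(1)[OF i(2) K \<psi>])
  have "compact (\<psi> ` K)"
    using K(1) \<psi>(1) compact_continuous_image continuous_on_subset by blast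
  then obtain B where B: "\<And>x. x \<in> K \<Longrightarrow> \<bar>\<psi> x\<bar> \<le> B"
    by (metis compact_imp_bounded bounded_iff image_eqI real_norm_def)
  have Ks: "K \<in> sets lebesgue" using K(1) by (simp add: borel_compact)
  let ?d = "\<lambda>n x. indicator K x *\<^sub>R v n x - indicator K x *\<^sub>R u x"
  have dm: "?d n \<in> borel_measurable lebesgue" for n
    using i unfolding set_integrable_def by (intro borel_measurable_diff) auto
  have le: "(\<integral>\<^sup>+x. ennreal (norm (indicator D x *\<^sub>R (v n x * \<psi> x) - indicator D x *\<^sub>R (u x * \<psi> x))) \<partial>lebesgue)
      \<le> ennreal \<bar>B\<bar> * (\<integral>\<^sup>+x\<in>K. ennreal \<bar>v n x - u x\<bar> \<partial>lebesgue)" for n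
  proof -
    have "(\<integral>\<^sup>+x. ennreal (norm (indicator D x *\<^sub>R (v n x * \<psi> x) - indicator D x *\<^sub>R (u x * \<psi> x))) \<partial>lebesgue)
      \<le> (\<integral>\<^sup>+x. ennreal \<bar>B\<bar> * ennreal \<bar>?d n x\<bar> \<partial>lebesgue)"
    proof (rule nn_integral_mono)
      fix x
      have "\<bar>v n x * \<psi> x - u x * \<psi> x\<bar> \<le> \<bar>B\<bar> * \<bar>v n x - u x\<bar>" if "x \<in> K"
      proof -
        have "\<bar>\<psi> x\<bar> * \<bar>v n x - u x\<bar> \<le> \<bar>B\<bar> * \<bar>v n x - u x\<bar>"
          using B[OF that] by (intro mult_right_mono) auto
        moreover have "v n x * \<psi> x - u x * \<psi> x = \<psi> x * (v n x - u x)" by (simp add: algebra_simps)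
        ultimately show ?thesis by (simp add: abs_mult)
      qed
      then show "ennreal (norm (indicator D x *\<^sub>R (v n x * \<psi> x) - indicator D x *\<^sub>R (u x * \<psi> x)))
          \<le> ennreal \<bar>B\<bar> * ennreal \<bar>?d n x\<bar>"
        using K(2) \<psi>(2)[of x] by (cases "x \<in> K") (auto simp: ennreal_mult[symmetric] intro!: ennreal_leI)
    qed
    also have "\<dots> = ennreal \<bar>B\<bar> * (\<integral>\<^sup>+x. ennreal \<bar>?d n x\<bar> \<partial>lebesgue)"
      using dm by (intro nn_integral_cmult) auto
    also have "(\<integral>\<^sup>+x. ennreal \<bar>?d n x\<bar> \<partial>lebesgue) = (\<integral>\<^sup>+x\<in>K. ennreal \<bar>v n x - u x\<bar> \<partial>lebesgue)"
      by (rule nn_integral_cong) (auto simp: indicator_def)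
    finally show ?thesis .
  qed
  have "(\<lambda>n. ennreal \<bar>B\<bar> * (\<integral>\<^sup>+x\<in>K. ennreal \<bar>v n x - u x\<bar> \<partial>lebesgue)) \<longlonglongrightarrow> ennreal \<bar>B\<bar> * 0"
    by (rule tendsto_mult_ennreal[OF tendsto_const lim]) simp
  then have l0: "(\<lambda>n. ennreal \<bar>B\<bar> * (\<integral>\<^sup>+x\<in>K. ennreal \<bar>v n x - u x\<bar> \<partial>lebesgue)) \<longlonglongrightarrow> 0"
    by simp
  have L: "(\<lambda>n. \<integral>\<^sup>+x. ennreal (norm (indicator D x *\<^sub>R (v n x * \<psi> x) - indicator D x *\<^sub>R (u x * \<psi> x))) \<partial>lebesgue) \<longlonglongrightarrow> 0"
    by (rule tendsto_sandwich[OF always_eventually always_eventually tendsto_const l0]) (use le in auto)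
  show ?thesis
    unfolding set_lebesgue_integral_def
    by (rule tendsto_L1_int[OF _ _ L]) (use int int' in \<open>auto simp: set_integrable_def\<close>)
qed

section \<open>Closedness\<close>

lemma continuous_imp_locally_integrable:
  fixes u :: "real^'n \<Rightarrow> real"
  assumes "continuous_on D u"
  shows "locally_integrable D u"
  unfolding locally_integrable_def set_integrable_def
proof (intro allI impI)
  fix K assume "compact K \<and> K \<subseteq> D"
  then have "integrable lborel (\<lambda>x. indicator K x *\<^sub>R u x)"
    using assms by (intro borel_integrable_compact) (auto intro: continuous_on_subset)
  moreover from this have "(\<lambda>x. indicator K x *\<^sub>R u x) \<in> borel_measurable lborel"
    by (rule borel_measurable_integrable)
  ultimately show "integrable lebesgue (\<lambda>x. indicator K x *\<^sub>R u x)"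
    by (simp only: integrable_completion)
qed

text \<open>Turns convergence in the weighted measure into L^1 convergence on each set where the
  weight is bounded below.\<close>

lemma nn_integral_le_density:
  assumes f: "f \<in> borel_measurable M" and w: "w \<in> borel_measurable M" and K: "K \<in> sets M"
    and c: "0 < c" "\<And>x. x \<in> K \<Longrightarrow> ennreal c \<le> w x"
  shows "(\<integral>\<^sup>+x\<in>K. f x \<partial>M) \<le> ennreal (1 / c) * (\<integral>\<^sup>+x. f x \<partial>density M w)"
proof -
  have "(\<integral>\<^sup>+x\<in>K. f x \<partial>M) \<le> (\<integral>\<^sup>+x. ennreal (1 / c) * (w x * f x) \<partial>M)"
  proof (rule nn_integral_mono)
    fix x
    have "f x = ennreal (1 / c) * (ennreal c * f x)"
      using c(1) by (simp add: mult.assoc[symmetric] ennreal_mult[symmetric])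
    also have "\<dots> \<le> ennreal (1 / c) * (w x * f x)" if "x \<in> K"
      using c(2)[OF that] by (intro mult_left_mono mult_right_mono) auto
    finally show "f x * indicator K x \<le> ennreal (1 / c) * (w x * f x)"
      by (cases "x \<in> K") auto
  qed
  also have "\<dots> = ennreal (1 / c) * (\<integral>\<^sup>+x. f x \<partial>density M w)"
    using f w by (simp add: nn_integral_cmult nn_integral_density)
  finally show ?thesis .
qed

lemma borel_measurable_matrix:
  fixes G :: "'a \<Rightarrow> real^'n^'m"
  assumes "\<And>i j. (\<lambda>x. G x $ i $ j) \<in> borel_measurable M"
  shows "G \<in> borel_measurable M"
proof (rule borel_measurable_euclidean_space[THEN iffD2], rule ballI)
  fix b :: "real^'n^'m" assume "b \<in> Basis"
  then obtain i j where "b = axis i (axis j 1)" by (auto simp: Basis_vec_def)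
  then have "(\<lambda>x. G x \<bullet> b) = (\<lambda>x. G x $ i $ j)" by (simp add: inner_axis)
  then show "(\<lambda>x. G x \<bullet> b) \<in> borel_measurable M" using assms by simp
qed

lemma abs_matrix_component_le: "\<bar>G $ i $ j\<bar> \<le> norm G" for G :: "real^'n^'m"
  using component_le_norm_cart[of "G $ i" j] Finite_Cartesian_Product.norm_nth_le[of G i] by linarith

lemma ennreal_midpoint:
  assumes "0 \<le> a" "0 \<le> b"
  shows "ennreal ((1/2) * a + (1/2) * b) = ennreal (1/2) * ennreal a + ennreal (1/2) * ennreal b"
proof -
  have "ennreal ((1/2) * a + (1/2) * b) = ennreal ((1/2) * a) + ennreal ((1/2) * b)"
    using assms by (intro ennreal_plus) auto
  also have "\<dots> = ennreal (1/2) * ennreal a + ennreal (1/2) * ennreal b"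
    using assms by (intro arg_cong2[of _ _ _ _ "(+)"] ennreal_mult) auto
  finally show ?thesis .
qed

text \<open>Convexity of \<phi> concerns numbers. Monotonicity is what carries it to vectors, since
  the norm of a midpoint is only at most the mean of the norms.\<close>

lemma convex_energy_midpoint:
  fixes \<phi> :: "ennreal \<Rightarrow> ennreal" and x y :: "'a::real_normed_vector"
  assumes "mono \<phi>" "ennreal_convex \<phi>"
  shows "\<phi> (ennreal (norm ((1/2) *\<^sub>R (x + y)))) \<le> ennreal (1/2) * \<phi> (ennreal (norm x)) + ennreal (1/2) * \<phi> (ennreal (norm y))"
proof -
  have "norm ((1/2) *\<^sub>R (x + y)) \<le> (1/2) * norm x + (1/2) * norm y"
    using norm_triangle_ineq[of x y] by simp
  then have "ennreal (norm ((1/2) *\<^sub>R (x + y))) \<le> ennreal ((1/2) * norm x + (1/2) * norm y)"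
    by (rule ennreal_leI)
  also have "\<dots> = ennreal (1/2) * ennreal (norm x) + ennreal (1 - 1/2) * ennreal (norm y)"
    by (subst ennreal_midpoint) auto
  finally have "\<phi> (ennreal (norm ((1/2) *\<^sub>R (x + y)))) \<le> \<phi> (ennreal (1/2) * ennreal (norm x) + ennreal (1 - 1/2) * ennreal (norm y))"
    by (rule monoD[OF assms(1)])
  also have "\<dots> \<le> ennreal (1/2) * \<phi> (ennreal (norm x)) + ennreal (1 - 1/2) * \<phi> (ennreal (norm y))"
    by (rule assms(2)[unfolded ennreal_convex_def, rule_format]) simp
  finally show ?thesis by simp
qed

lemma continuous_on_locally_uniform_limit:
  fixes F :: "nat \<Rightarrow> 'a::euclidean_space \<Rightarrow> 'b::metric_space"
  assumes "open D" "\<And>k. continuous_on D (F k)"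
    and lim: "\<And>K. compact K \<Longrightarrow> K \<subseteq> D \<Longrightarrow> uniform_limit K F g sequentially"
  shows "continuous_on D g"
proof (rule continuous_at_imp_continuous_on, rule ballI)
  fix x assume "x \<in> D"
  then obtain e where e: "0 < e" "cball x e \<subseteq> D"
    using assms(1) open_contains_cball by blast
  have "continuous_on (cball x e) g"
    by (rule uniform_limit_theorem[OF _ lim[OF compact_cball e(2)]])
       (auto intro!: always_eventually continuous_on_subset[OF assms(2) e(2)])
  then show "isCont g x"
    by (rule continuous_on_interior) (use e(1) in simp)
qed

text \<open>The elements are gradients, since these are what is minimized; the map is a mere witness
  f, held near g on K only. Matrix values put the gradients in an inner product space whose norm is
  \<open>grad_norm\<close>, as the parallelogram law requires.\<close>

definition matrix_energy_class ::
  "(ennreal \<Rightarrow> ennreal) \<Rightarrow> real \<Rightarrow> (real^'n) set \<Rightarrow> (real^'n) set \<Rightarrow> (real^'n \<Rightarrow> real^'m) \<Rightarrow> real \<Rightarrow> (real^'n \<Rightarrow> real^'n^'m) set" where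
  "matrix_energy_class \<phi> M D K g e = {G. G \<in> borel_measurable lebesgue \<and>
     (\<integral>\<^sup>+ x\<in>D. \<phi> (ennreal (norm (G x))) \<partial>lebesgue) \<le> ennreal M \<and>
     (\<exists>f. weak_jacobian D f (\<lambda>i j x. G x $ i $ j) \<and> (\<forall>x\<in>K. norm (f x - g x) \<le> e))}"

lemma matrix_energy_class_midpoint:
  fixes G H :: "real^'n \<Rightarrow> real^'n^'m"
  assumes D: "open D" and \<phi>: "\<phi> \<in> borel_measurable borel" "mono \<phi>" "ennreal_convex \<phi>"
    and G: "G \<in> matrix_energy_class \<phi> M D K g e" and H: "H \<in> matrix_energy_class \<phi> M D K g e"
    and M: "0 \<le> M"
  shows "(\<lambda>x. (1/2) *\<^sub>R (G x + H x)) \<in> matrix_energy_class \<phi> M D K g e"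
  unfolding matrix_energy_class_def
proof (intro CollectI conjI)
  have [measurable]: "G \<in> borel_measurable lebesgue" "H \<in> borel_measurable lebesgue"
    using G H unfolding matrix_energy_class_def by auto
  note [measurable] = \<phi>(1)
  have [measurable]: "D \<in> sets lebesgue" using D by (simp add: borel_open)
  show "(\<lambda>x. (1/2) *\<^sub>R (G x + H x)) \<in> borel_measurable lebesgue" by measurable
  have GM: "(\<integral>\<^sup>+ x\<in>D. \<phi> (ennreal (norm (G x))) \<partial>lebesgue) \<le> ennreal M"
    and HM: "(\<integral>\<^sup>+ x\<in>D. \<phi> (ennreal (norm (H x))) \<partial>lebesgue) \<le> ennreal M"
    using G H unfolding matrix_energy_class_def by auto
  have "(\<integral>\<^sup>+ x\<in>D. \<phi> (ennreal (norm ((1/2) *\<^sub>R (G x + H x)))) \<partial>lebesgue)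
     \<le> (\<integral>\<^sup>+ x. ennreal (1/2) * (\<phi> (ennreal (norm (G x))) * indicator D x)
         + ennreal (1/2) * (\<phi> (ennreal (norm (H x))) * indicator D x) \<partial>lebesgue)"
  proof (rule nn_integral_mono)
    fix x
    show "\<phi> (ennreal (norm ((1/2) *\<^sub>R (G x + H x)))) * indicator D x
       \<le> ennreal (1/2) * (\<phi> (ennreal (norm (G x))) * indicator D x)
         + ennreal (1/2) * (\<phi> (ennreal (norm (H x))) * indicator D x)"
      using convex_energy_midpoint[OF \<phi>(2,3), of "G x" "H x"] by (cases "x \<in> D") simp_all
  qed
  also have "\<dots> = ennreal (1/2) * (\<integral>\<^sup>+ x\<in>D. \<phi> (ennreal (norm (G x))) \<partial>lebesgue)
       + ennreal (1/2) * (\<integral>\<^sup>+ x\<in>D. \<phi> (ennreal (norm (H x))) \<partial>lebesgue)"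
    by (subst nn_integral_add) (auto simp: nn_integral_cmult)
  also have "\<dots> \<le> ennreal (1/2) * ennreal M + ennreal (1/2) * ennreal M"
    using GM HM by (intro add_mono mult_left_mono) auto
  also have "\<dots> = ennreal M"
    by (subst ennreal_midpoint[symmetric]) (use M in auto)
  finally show "(\<integral>\<^sup>+ x\<in>D. \<phi> (ennreal (norm ((1/2) *\<^sub>R (G x + H x)))) \<partial>lebesgue) \<le> ennreal M" .
  obtain f1 where f1: "weak_jacobian D f1 (\<lambda>i j x. G x $ i $ j)" "\<And>x. x \<in> K \<Longrightarrow> norm (f1 x - g x) \<le> e"
    using G unfolding matrix_energy_class_def by auto
  obtain f2 where f2: "weak_jacobian D f2 (\<lambda>i j x. H x $ i $ j)" "\<And>x. x \<in> K \<Longrightarrow> norm (f2 x - g x) \<le> e"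
    using H unfolding matrix_energy_class_def by auto
  show "\<exists>f. weak_jacobian D f (\<lambda>i j x. ((1/2) *\<^sub>R (G x + H x)) $ i $ j) \<and> (\<forall>x\<in>K. norm (f x - g x) \<le> e)"
  proof (intro exI conjI ballI)
    show "weak_jacobian D (\<lambda>x. (1/2) *\<^sub>R (f1 x + f2 x)) (\<lambda>i j x. ((1/2) *\<^sub>R (G x + H x)) $ i $ j)"
      unfolding weak_jacobian_def
    proof (intro allI)
      fix i j
      have "weak_partial D j (\<lambda>x. (1/2) * (f1 x $ i + f2 x $ i)) (\<lambda>x. (1/2) * (G x $ i $ j + H x $ i $ j))"
        using f1(1) f2(1) unfolding weak_jacobian_def by (intro weak_partial_midpoint) auto
      then show "weak_partial D j (\<lambda>x. ((1/2) *\<^sub>R (f1 x + f2 x)) $ i) (\<lambda>x. ((1/2) *\<^sub>R (G x + H x)) $ i $ j)"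
        by (simp only: vector_scaleR_component vector_add_component real_scaleR_def)
    qed
    fix x assume x: "x \<in> K"
    have "(1/2) *\<^sub>R (f1 x + f2 x) - g x = (1/2) *\<^sub>R ((f1 x - g x) + (f2 x - g x))"
      by (simp add: vec_eq_iff field_simps)
    then have "norm ((1/2) *\<^sub>R (f1 x + f2 x) - g x) \<le> (1/2) * (norm (f1 x - g x) + norm (f2 x - g x))"
      using norm_triangle_ineq[of "f1 x - g x" "f2 x - g x"] by simp
    also have "\<dots> \<le> (1/2) * (e + e)"
      using f1(2)[OF x] f2(2)[OF x] by (intro mult_left_mono add_mono) auto
    finally show "norm ((1/2) *\<^sub>R (f1 x + f2 x) - g x) \<le> e" by simp
  qed
qed

lemma family_F_matrix_energy_class:
  fixes f :: "real^'n \<Rightarrow> real^'m"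
  assumes D: "open D" and f: "f \<in> family_F \<phi> M D x0" and e: "\<forall>x\<in>K. norm (f x - g x) \<le> e"
  obtains G where "G \<in> matrix_energy_class \<phi> M D K g e"
proof -
  obtain h where h: "weak_jacobian D f h" "(\<integral>\<^sup>+ x\<in>D. \<phi> (ennreal (grad_norm h x)) \<partial>lebesgue) \<le> ennreal M"
    using f unfolding family_F_def by blast
  \<comment> \<open>Extension by zero outside D, where h need not be measurable.\<close>
  define G :: "real^'n \<Rightarrow> real^'n^'m" where "G x = (\<chi> i j. indicator D x * h i j x)" for x
  have wp: "weak_partial D j (\<lambda>x. f x $ i) (h i j)" for i j
    using h(1) unfolding weak_jacobian_def by blast
  then have li: "locally_integrable D (h i j)" for i j
    unfolding weak_partial_def by blast
  show thesis
  proof (rule that[of G], unfold matrix_energy_class_def, intro CollectI conjI exI[of _ f] e)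
    show "G \<in> borel_measurable lebesgue"
      by (rule borel_measurable_matrix) (simp add: G_def locally_integrable_measurable[OF D li])
    have "norm (G x) = grad_norm h x" if "x \<in> D" for x
    proof -
      have "grad_norm (\<lambda>i j x. G x $ i $ j) x = grad_norm h x"
        using that by (simp add: grad_norm_def G_def)
      then show ?thesis by (simp only: grad_norm_matrix)
    qed
    then have "(\<integral>\<^sup>+ x\<in>D. \<phi> (ennreal (norm (G x))) \<partial>lebesgue) = (\<integral>\<^sup>+ x\<in>D. \<phi> (ennreal (grad_norm h x)) \<partial>lebesgue)"
      by (intro nn_integral_cong) (simp add: indicator_def)
    with h(2) show "(\<integral>\<^sup>+ x\<in>D. \<phi> (ennreal (norm (G x))) \<partial>lebesgue) \<le> ennreal M" by simp
    show "weak_jacobian D f (\<lambda>i j x. G x $ i $ j)"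
      unfolding weak_jacobian_def
      by (intro allI weak_partial_cong[OF D wp]) (simp add: G_def)
  qed
qed


text \<open>For a fixed test function both sides of the identity are linear functionals, continuous
  for L^1 convergence on its support; uniform convergence of the maps there implies L^1 convergence,
  as the support has finite volume.\<close>

lemma weak_jacobian_limit:
  fixes f :: "nat \<Rightarrow> real^'n \<Rightarrow> real^'m" and G :: "nat \<Rightarrow> real^'n \<Rightarrow> real^'n^'m"
  assumes D: "open D"
    and wj: "\<And>k. weak_jacobian D (f k) (\<lambda>i j x. G k x $ i $ j)"
    and f: "\<And>K. compact K \<Longrightarrow> K \<subseteq> D \<Longrightarrow> uniform_limit K f g sequentially"
    and g: "continuous_on D g" and L: "L \<in> borel_measurable lebesgue"
    and lim: "\<And>K. compact K \<Longrightarrow> K \<subseteq> D \<Longrightarrow> (\<lambda>k. \<integral>\<^sup>+x\<in>K. ennreal (norm (G k x - L x)) \<partial>lebesgue) \<longlonglongrightarrow> 0"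
  shows "weak_jacobian D g (\<lambda>i j x. L x $ i $ j)"
  unfolding weak_jacobian_def
proof (intro allI)
  fix i j
  have wp: "weak_partial D j (\<lambda>x. f k x $ i) (\<lambda>x. G k x $ i $ j)" for k
    using wj unfolding weak_jacobian_def by blast
  then have lf: "locally_integrable D (\<lambda>x. f k x $ i)" and lG: "locally_integrable D (\<lambda>x. G k x $ i $ j)" for k
    unfolding weak_partial_def by auto
  have lg: "locally_integrable D (\<lambda>x. g x $ i)"
    by (rule continuous_imp_locally_integrable[OF continuous_on_component[OF g]])
  have limG: "(\<lambda>k. \<integral>\<^sup>+x\<in>K. ennreal \<bar>G k x $ i $ j - L x $ i $ j\<bar> \<partial>lebesgue) \<longlonglongrightarrow> 0"
    if K: "compact K" "K \<subseteq> D" for K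
  proof (rule tendsto_sandwich[OF always_eventually always_eventually tendsto_const lim[OF K]])
    show "\<forall>k. (\<integral>\<^sup>+x\<in>K. ennreal \<bar>G k x $ i $ j - L x $ i $ j\<bar> \<partial>lebesgue)
        \<le> (\<integral>\<^sup>+x\<in>K. ennreal (norm (G k x - L x)) \<partial>lebesgue)"
    proof (intro allI nn_integral_mono mult_right_mono ennreal_leI)
      show "\<bar>G k x $ i $ j - L x $ i $ j\<bar> \<le> norm (G k x - L x)" for k x
        using abs_matrix_component_le[of "G k x - L x" i j] by simp
    qed simp
  qed simp
  have Lm: "(\<lambda>x. L x $ i $ j) \<in> borel_measurable lebesgue"
  proof -
    have "(\<lambda>x. L x \<bullet> axis i (axis j 1)) \<in> borel_measurable lebesgue"
      using L by measurable
    then show ?thesis by (simp add: inner_axis)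
  qed
  have lL: "locally_integrable D (\<lambda>x. L x $ i $ j)"
    unfolding locally_integrable_def
  proof (intro allI impI)
    fix K assume K: "compact K \<and> K \<subseteq> D"
    have Km: "K \<in> sets lebesgue" using K by (simp add: borel_compact)
    \<comment> \<open>L inherits integrability on K from one G k at finite L^1 distance.\<close>
    have "\<forall>\<^sub>F k in sequentially. (\<integral>\<^sup>+x\<in>K. ennreal \<bar>G k x $ i $ j - L x $ i $ j\<bar> \<partial>lebesgue) < 1"
      using order_tendstoD(2)[OF limG, of K 1] K by simp
    then obtain k where k: "(\<integral>\<^sup>+x\<in>K. ennreal \<bar>G k x $ i $ j - L x $ i $ j\<bar> \<partial>lebesgue) < 1"
      by (auto simp: eventually_sequentially)
    have Gi: "integrable lebesgue (\<lambda>x. indicator K x *\<^sub>R (G k x $ i $ j))"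
      using lG K unfolding locally_integrable_def set_integrable_def by blast
    have "integrable lebesgue (\<lambda>x. indicator K x *\<^sub>R (G k x $ i $ j) - indicator K x *\<^sub>R (L x $ i $ j))"
    proof (rule integrableI_bounded)
      show "(\<lambda>x. indicator K x *\<^sub>R (G k x $ i $ j) - indicator K x *\<^sub>R (L x $ i $ j)) \<in> borel_measurable lebesgue"
        using Lm Km by (intro borel_measurable_diff borel_measurable_integrable[OF Gi] borel_measurable_scaleR) auto
      have "(\<integral>\<^sup>+x. ennreal (norm (indicator K x *\<^sub>R (G k x $ i $ j) - indicator K x *\<^sub>R (L x $ i $ j))) \<partial>lebesgue)
          = (\<integral>\<^sup>+x\<in>K. ennreal \<bar>G k x $ i $ j - L x $ i $ j\<bar> \<partial>lebesgue)"
        by (rule nn_integral_cong) (auto simp: indicator_def)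
      also have "\<dots> < \<infinity>" using k by (rule order.strict_trans) simp
      finally show "(\<integral>\<^sup>+x. ennreal (norm (indicator K x *\<^sub>R (G k x $ i $ j) - indicator K x *\<^sub>R (L x $ i $ j))) \<partial>lebesgue) < \<infinity>" .
    qed
    from Bochner_Integration.integrable_diff[OF Gi this]
    show "set_integrable lebesgue K (\<lambda>x. L x $ i $ j)"
      by (simp add: set_integrable_def)
  qed
  have limf: "(\<lambda>k. \<integral>\<^sup>+x\<in>K. ennreal \<bar>f k x $ i - g x $ i\<bar> \<partial>lebesgue) \<longlonglongrightarrow> 0"
    if K: "compact K" "K \<subseteq> D" for K
  proof (rule tendsto_zero_ennreal)
    fix r :: real assume r: "0 < r"
    \<comment> \<open>The 1 in the denominator covers compact sets of measure zero.\<close>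
    define e where "e = r / (1 + measure lebesgue K)"
    have pos: "0 < 1 + measure lebesgue K" by (simp add: add_pos_nonneg)
    then have e: "0 < e" using r by (simp add: e_def)
    have "\<forall>\<^sub>F k in sequentially. \<forall>x\<in>K. dist (f k x) (g x) < e"
      by (rule uniform_limitD[OF f[OF K] e])
    then show "\<forall>\<^sub>F k in sequentially. (\<integral>\<^sup>+x\<in>K. ennreal \<bar>f k x $ i - g x $ i\<bar> \<partial>lebesgue) < ennreal r"
    proof eventually_elim
      case (elim k)
      have "(\<integral>\<^sup>+x\<in>K. ennreal \<bar>f k x $ i - g x $ i\<bar> \<partial>lebesgue) \<le> (\<integral>\<^sup>+x. ennreal e * indicator K x \<partial>lebesgue)"
      proof (rule nn_integral_mono)
        fix x
        have "\<bar>f k x $ i - g x $ i\<bar> \<le> e" if "x \<in> K"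
          using elim that component_le_norm_cart[of "f k x - g x" i] by (fastforce simp: dist_norm)
        then show "ennreal \<bar>f k x $ i - g x $ i\<bar> * indicator K x \<le> ennreal e * indicator K x"
          by (cases "x \<in> K") (auto intro: ennreal_leI)
      qed
      also have "\<dots> = ennreal e * emeasure lebesgue K"
        using K by (intro nn_integral_cmult_indicator) (simp add: borel_compact)
      also have "emeasure lebesgue K = ennreal (measure lebesgue K)"
        using K by (intro emeasure_eq_measure2 lmeasurable_compact)
      also have "ennreal e * ennreal (measure lebesgue K) = ennreal (e * measure lebesgue K)"
        using e by (simp add: ennreal_mult)
      also have "\<dots> < ennreal r"
      proof (rule ennreal_lessI[OF r])
        have "e * measure lebesgue K < e * (1 + measure lebesgue K)" using e by simp
        also have "\<dots> = r" using pos by (simp add: e_def)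
        finally show "e * measure lebesgue K < r" .
      qed
      finally show ?case .
    qed
  qed
  show "weak_partial D j (\<lambda>x. g x $ i) (\<lambda>x. L x $ i $ j)"
    unfolding weak_partial_def
  proof (intro conjI allI impI lg lL)
    fix \<psi> assume t: "test_fun D \<psi>"
    obtain K where K: "compact K" "K \<subseteq> D" "continuous_on UNIV \<psi>" "\<And>x. x \<notin> K \<Longrightarrow> \<psi> x = 0"
      "continuous_on UNIV (\<lambda>x. frechet_derivative \<psi> (at x) (axis j 1))"
      "\<And>x. x \<notin> K \<Longrightarrow> frechet_derivative \<psi> (at x) (axis j 1) = 0"
      using test_fun_supports[OF t, of "axis j 1"] by blast
    have "(\<lambda>k. LINT x:D|lebesgue. f k x $ i * frechet_derivative \<psi> (at x) (axis j 1))
        \<longlonglongrightarrow> (LINT x:D|lebesgue. g x $ i * frechet_derivative \<psi> (at x) (axis j 1))"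
      by (rule tendsto_LINT_mult[OF lf lg K(1,2,5,6) limf[OF K(1,2)]])
    moreover have "(LINT x:D|lebesgue. f k x $ i * frechet_derivative \<psi> (at x) (axis j 1))
        = - (LINT x:D|lebesgue. G k x $ i $ j * \<psi> x)" for k
      using wp[of k] t unfolding weak_partial_def by blast
    moreover have "(\<lambda>k. - (LINT x:D|lebesgue. G k x $ i $ j * \<psi> x)) \<longlonglongrightarrow> - (LINT x:D|lebesgue. L x $ i $ j * \<psi> x)"
      by (rule tendsto_minus[OF tendsto_LINT_mult[OF lG lL K(1-4) limG[OF K(1,2)]]])
    ultimately show "(LINT x:D|lebesgue. g x $ i * frechet_derivative \<psi> (at x) (axis j 1)) = - (LINT x:D|lebesgue. L x $ i $ j * \<psi> x)"
      using LIMSEQ_unique by auto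
  qed
qed


text \<open>Continuity and the value at x0 pass directly to the limit. For the gradient, the given
  sequence serves to show that the competing classes are nonempty; its own gradients are then
  abandoned for almost minimizers, whose maps still converge to g.\<close>

lemma family_F_closed:
  fixes F :: "nat \<Rightarrow> real^'n \<Rightarrow> real^'m" and \<phi> :: "ennreal \<Rightarrow> ennreal"
  assumes D: "open D" and x0: "x0 \<in> D" and M: "0 \<le> M"
    and \<phi>: "continuous_on UNIV \<phi>" "mono \<phi>" "ennreal_convex \<phi>"
    and AB: "0 \<le> A" "0 \<le> B" "\<And>t. 0 \<le> t \<Longrightarrow> ennreal (t powr p) \<le> ennreal A * \<phi> (ennreal t) + ennreal B"
    and p: "2 \<le> p"
    and F: "\<And>k. F k \<in> family_F \<phi> M D x0"
    and lim: "\<And>K. compact K \<Longrightarrow> K \<subseteq> D \<Longrightarrow> uniform_limit K F g sequentially"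
  shows "g \<in> family_F \<phi> M D x0"
proof -
  have \<phi>m [measurable]: "\<phi> \<in> borel_measurable borel"
    using \<phi>(1) by (rule borel_measurable_continuous_onI)
  have cg: "continuous_on D g"
    by (rule continuous_on_locally_uniform_limit[OF D _ lim]) (use F in \<open>auto simp: family_F_def\<close>)
  have g0: "g x0 = 0"
  proof -
    have "(\<lambda>k. F k x0) \<longlonglongrightarrow> g x0"
      by (rule tendsto_uniform_limitI[OF lim[of "{x0}"]]) (use x0 in auto)
    moreover have "F k x0 = 0" for k using F[of k] by (simp add: family_F_def)
    ultimately show ?thesis by (simp add: LIMSEQ_const_iff)
  qed
  obtain C where C: "\<And>n. compact (C n)" "\<And>n. C n \<subseteq> D" "\<And>n. C n \<subseteq> interior (C (Suc n))"
    "\<Union> (range C) = D" "\<And>K. compact K \<Longrightarrow> K \<subseteq> D \<Longrightarrow> \<exists>N. \<forall>n\<ge>N. K \<subseteq> C n"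
    using open_Union_compact_subsets[OF D] by metis
  have Cmono: "C n \<subseteq> C n'" if "n \<le> n'" for n n'
  proof (rule lift_Suc_mono_le[OF _ that])
    show "C n \<subseteq> C (Suc n)" for n using C(3)[of n] interior_subset[of "C (Suc n)"] by simp
  qed
  obtain w where w: "w \<in> borel_measurable lebesgue" "\<And>x. w x \<le> indicator D x"
    "(\<integral>\<^sup>+x. w x \<partial>lebesgue) \<le> 1" "\<And>x. x \<in> D \<Longrightarrow> 0 < w x"
    "\<And>N. \<exists>c>0. \<forall>x\<in>C N. ennreal c \<le> w x"
    using exhaustion_weight[of C D] C(1,4) by metis
  note [measurable] = w(1)
  have [measurable]: "D \<in> sets lebesgue" using D by (simp add: borel_open)
  define \<mu> where "\<mu> = density lebesgue w"
  define S :: "nat \<Rightarrow> (real^'n \<Rightarrow> real^'n^'m) set"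
    where "S N = matrix_energy_class \<phi> M D (C N) g (1 / real (Suc N))" for N
  have Sm: "G \<in> borel_measurable lebesgue" if "G \<in> S N" for G N
    using that unfolding S_def matrix_energy_class_def by auto
  have SM: "(\<integral>\<^sup>+ x\<in>D. \<phi> (ennreal (norm (G x))) \<partial>lebesgue) \<le> ennreal M" if "G \<in> S N" for G N
    using that unfolding S_def matrix_energy_class_def by auto
  obtain G L where GL: "\<And>k. G k \<in> S k" "L \<in> borel_measurable \<mu>"
    "AE x in \<mu>. (\<lambda>k. G k x) \<longlonglongrightarrow> L x"
    "(\<lambda>k. \<integral>\<^sup>+x. ennreal (norm (G k x - L x)) \<partial>\<mu>) \<longlonglongrightarrow> 0"
  \<comment> \<open>By p \<ge> 2, |G|^2 is at most 1 + |G|^p, hence at most A \<phi>(|G|) + B + 1.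
    After weighting, the energy part contributes at most A * M because w is below the indicator of
    D, and the constant at most B + 1 because w has mass at most 1.\<close>
  proof (rule minimizing_sequence_convergence[of \<mu> S "A * M + B + 1"])
    have "emeasure \<mu> (space \<mu>) = (\<integral>\<^sup>+x. w x \<partial>lebesgue)"
      unfolding \<mu>_def using w(1) by (simp add: emeasure_density)
    then show "finite_measure \<mu>"
      using w(3) by (intro finite_measureI) (auto simp: top_unique)
    show "G \<in> borel_measurable \<mu>" if "G \<in> S N" for N G
      using Sm[OF that] by (simp add: \<mu>_def)
    show "S N' \<subseteq> S N" if "N \<le> N'" for N N'
    proof -
      have "1 / real (Suc N') \<le> 1 / real (Suc N)" using that by (intro divide_left_mono) auto
      then show ?thesis
        unfolding S_def matrix_energy_class_def using Cmono[OF that] by (blast intro: order_trans)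
    qed
    show "S N \<noteq> {}" for N
    proof -
      have "\<forall>\<^sub>F k in sequentially. \<forall>x\<in>C N. dist (F k x) (g x) < 1 / real (Suc N)"
        by (rule uniform_limitD[OF lim[OF C(1,2)]]) simp
      then obtain k where "\<forall>x\<in>C N. dist (F k x) (g x) < 1 / real (Suc N)"
        unfolding eventually_sequentially by blast
      then have "\<forall>x\<in>C N. norm (F k x - g x) \<le> 1 / real (Suc N)"
        by (simp add: dist_norm less_imp_le)
      from family_F_matrix_energy_class[OF D F this] show ?thesis
        unfolding S_def by blast
    qed
    show "(\<lambda>x. (1/2) *\<^sub>R (G x + H x)) \<in> S N" if "G \<in> S N" "H \<in> S N" for N G H
      using that unfolding S_def by (rule matrix_energy_class_midpoint[OF D \<phi>m \<phi>(2,3) _ _ M])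
    show "(\<integral>\<^sup>+x. ennreal ((norm (G x))\<^sup>2) \<partial>\<mu>) \<le> ennreal (A * M + B + 1)" if G: "G \<in> S N" for N G
    proof -
      note [measurable] = Sm[OF G]
      have "(\<integral>\<^sup>+x. ennreal ((norm (G x))\<^sup>2) \<partial>\<mu>) = (\<integral>\<^sup>+x. w x * ennreal ((norm (G x))\<^sup>2) \<partial>lebesgue)"
        unfolding \<mu>_def by (rule nn_integral_density) measurable
      also have "\<dots> \<le> (\<integral>\<^sup>+x. ennreal A * (\<phi> (ennreal (norm (G x))) * indicator D x) + ennreal (B + 1) * w x \<partial>lebesgue)"
      proof (rule nn_integral_mono)
        fix x
        have "(norm (G x))\<^sup>2 \<le> 1 + norm (G x) powr p"
        proof (cases "norm (G x) \<le> 1")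
          case True
          then have "(norm (G x))\<^sup>2 \<le> 1" by (simp add: power_le_one)
          then show ?thesis by (simp add: add_increasing2)
        next
          case False
          then have "(norm (G x))\<^sup>2 = norm (G x) powr 2" by (simp add: powr_numeral)
          also have "\<dots> \<le> norm (G x) powr p" using False p by (intro powr_mono) auto
          finally show ?thesis by simp
        qed
        then have "ennreal ((norm (G x))\<^sup>2) \<le> ennreal (1 + norm (G x) powr p)"
          by (rule ennreal_leI)
        also have "\<dots> = ennreal 1 + ennreal (norm (G x) powr p)" by (rule ennreal_plus) auto
        also have "\<dots> \<le> ennreal 1 + (ennreal A * \<phi> (ennreal (norm (G x))) + ennreal B)"
          by (intro add_left_mono AB(3)) simp
        also have "\<dots> = ennreal A * \<phi> (ennreal (norm (G x))) + ennreal (B + 1)"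
          using AB(2) by (simp add: ennreal_plus ac_simps)
        finally have "w x * ennreal ((norm (G x))\<^sup>2) \<le> w x * (ennreal A * \<phi> (ennreal (norm (G x))) + ennreal (B + 1))"
          by (rule mult_left_mono) simp
        also have "\<dots> = w x * (ennreal A * \<phi> (ennreal (norm (G x)))) + ennreal (B + 1) * w x"
          by (simp only: distrib_left mult.commute)
        also have "\<dots> \<le> indicator D x * (ennreal A * \<phi> (ennreal (norm (G x)))) + ennreal (B + 1) * w x"
          using w(2) by (intro add_right_mono mult_right_mono) auto
        finally show "w x * ennreal ((norm (G x))\<^sup>2) \<le> ennreal A * (\<phi> (ennreal (norm (G x))) * indicator D x) + ennreal (B + 1) * w x"
          by (simp only: ac_simps)
      qed
      also have "\<dots> = ennreal A * (\<integral>\<^sup>+ x\<in>D. \<phi> (ennreal (norm (G x))) \<partial>lebesgue) + ennreal (B + 1) * (\<integral>\<^sup>+x. w x \<partial>lebesgue)"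
        by (subst nn_integral_add) (auto simp: nn_integral_cmult)
      also have "\<dots> \<le> ennreal A * ennreal M + ennreal (B + 1) * 1"
        using SM[OF G] w(3) by (intro add_mono mult_left_mono) auto
      also have "\<dots> = ennreal (A * M) + ennreal (B + 1)"
        using AB(1) M by (simp add: ennreal_mult)
      also have "\<dots> = ennreal (A * M + (B + 1))"
        using AB M by (intro ennreal_plus[symmetric]) auto
      finally show ?thesis by (simp add: add.assoc)
    qed
  qed (rule that)
  have Gm [measurable]: "G k \<in> borel_measurable lebesgue" for k using Sm GL(1) by blast
  have Lm [measurable]: "L \<in> borel_measurable lebesgue" using GL(2) by (simp add: \<mu>_def)
  \<comment> \<open>Since w is positive on D, sets that are null for \<mu> meet D in Lebesgue null
    sets.\<close>
  have AE: "AE x in lebesgue. x \<in> D \<longrightarrow> (\<lambda>k. G k x) \<longlonglongrightarrow> L x"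
    using GL(3) w(4) unfolding \<mu>_def AE_density[OF w(1)] by (auto elim!: eventually_mono)
  have energy: "(\<integral>\<^sup>+ x\<in>D. \<phi> (ennreal (norm (L x))) \<partial>lebesgue) \<le> ennreal M"
  proof (rule fatou_le)
    show "AE x in lebesgue. (\<lambda>k. \<phi> (ennreal (norm (G k x))) * indicator D x) \<longlonglongrightarrow> \<phi> (ennreal (norm (L x))) * indicator D x"
      using AE
    proof eventually_elim
      case (elim x)
      show ?case
      proof (cases "x \<in> D")
        case True
        then have "(\<lambda>k. ennreal (norm (G k x))) \<longlonglongrightarrow> ennreal (norm (L x))"
          using elim by (intro tendsto_intros) auto
        \<comment> \<open>Continuity is meant in [0,\<infinity>], so infinite values of \<phi> are
          covered.\<close>
        then have "(\<lambda>k. \<phi> (ennreal (norm (G k x)))) \<longlonglongrightarrow> \<phi> (ennreal (norm (L x)))"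
          by (rule continuous_on_tendsto_compose[OF \<phi>(1)]) auto
        then show ?thesis using True by simp
      qed simp
    qed
    show "\<forall>\<^sub>F k in sequentially. (\<integral>\<^sup>+ x\<in>D. \<phi> (ennreal (norm (G k x))) \<partial>lebesgue) \<le> ennreal M"
      using SM GL(1) by (intro always_eventually) blast
  qed measurable
  have limL: "(\<lambda>k. \<integral>\<^sup>+x\<in>K. ennreal (norm (G k x - L x)) \<partial>lebesgue) \<longlonglongrightarrow> 0"
    if K: "compact K" "K \<subseteq> D" for K
  proof -
    obtain N where N: "K \<subseteq> C N" using C(5)[OF K] by blast
    obtain c where c: "0 < c" "\<And>x. x \<in> C N \<Longrightarrow> ennreal c \<le> w x" using w(5) by blast
    have le: "(\<integral>\<^sup>+x\<in>K. ennreal (norm (G k x - L x)) \<partial>lebesgue)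
        \<le> ennreal (1 / c) * (\<integral>\<^sup>+x. ennreal (norm (G k x - L x)) \<partial>\<mu>)" for k
      unfolding \<mu>_def
      by (rule nn_integral_le_density[OF _ w(1) _ c(1)]) (use K N c(2) in \<open>auto simp: borel_compact\<close>)
    have "(\<lambda>k. ennreal (1 / c) * (\<integral>\<^sup>+x. ennreal (norm (G k x - L x)) \<partial>\<mu>)) \<longlonglongrightarrow> ennreal (1 / c) * 0"
      by (rule tendsto_mult_ennreal[OF tendsto_const GL(4)]) simp
    then have l0: "(\<lambda>k. ennreal (1 / c) * (\<integral>\<^sup>+x. ennreal (norm (G k x - L x)) \<partial>\<mu>)) \<longlonglongrightarrow> 0"
      by simp
    show ?thesis
      by (rule tendsto_sandwich[OF always_eventually always_eventually tendsto_const l0]) (use le in auto)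
  qed
  have "\<exists>f. weak_jacobian D f (\<lambda>i j x. G k x $ i $ j) \<and> (\<forall>x\<in>C k. norm (f x - g x) \<le> 1 / real (Suc k))" for k
    using GL(1)[of k] unfolding S_def matrix_energy_class_def by blast
  then obtain f where f: "\<And>k. weak_jacobian D (f k) (\<lambda>i j x. G k x $ i $ j)"
    "\<And>k x. x \<in> C k \<Longrightarrow> norm (f k x - g x) \<le> 1 / real (Suc k)" by metis
  have ulim: "uniform_limit K f g sequentially" if K: "compact K" "K \<subseteq> D" for K
  proof (rule uniform_limitI)
    fix e :: real assume e: "0 < e"
    obtain N where N: "\<And>n. N \<le> n \<Longrightarrow> K \<subseteq> C n" using C(5)[OF K] by blast
    obtain N' where N': "1 / real (Suc N') < e"
      using e nat_approx_posE by blast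
    have "dist (f n x) (g x) < e" if n: "max N N' \<le> n" and x: "x \<in> K" for n x
    proof -
      have "norm (f n x - g x) \<le> 1 / real (Suc n)" using f(2) N[of n] n x by auto
      also have "\<dots> \<le> 1 / real (Suc N')" using n by (intro divide_left_mono) auto
      finally show ?thesis using N' by (simp add: dist_norm)
    qed
    then show "\<forall>\<^sub>F n in sequentially. \<forall>x\<in>K. dist (f n x) (g x) < e"
      unfolding eventually_sequentially by blast
  qed
  have "weak_jacobian D g (\<lambda>i j x. L x $ i $ j)"
    by (rule weak_jacobian_limit[OF D f(1) ulim cg Lm limL])
  moreover from this have "W11_loc D g" unfolding W11_loc_def by blast
  moreover have "(\<integral>\<^sup>+ x\<in>D. \<phi> (ennreal (grad_norm (\<lambda>i j x. L x $ i $ j) x)) \<partial>lebesgue) \<le> ennreal M"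
    using energy by (simp only: grad_norm_matrix)
  ultimately show ?thesis
    unfolding family_F_def using cg g0 by blast
qed

theorem theorem2p1:
  fixes D :: "(real^'n) set" and M :: real and x0 :: "real^'n"
    and \<phi> :: "ennreal \<Rightarrow> ennreal" and t_star \<alpha> :: real
  assumes n2: "CARD('n) \<ge> 2"
    and dom: "open D" "connected D"
    and M: "0 \<le> M"
    and x0: "x0 \<in> D"
    and phi_cont: "continuous_on UNIV \<phi>"
    and phi_mono: "mono \<phi>"
    and phi_convex: "ennreal_convex \<phi>"
    and phi_nonconst: "\<exists>a b. \<phi> a \<noteq> \<phi> b"
    and tstar: "ennreal t_star > Sup {t. \<phi> t = 0}"
    and alpha: "0 < \<alpha>" "\<alpha> < 1 / (real CARD('n) - 1)"
    and integral: "(\<integral>\<^sup>+ t\<in>{t_star..}. ennreal ((t / enn2real (\<phi> (ennreal t))) powr \<alpha>) \<partial>lborel) < \<infinity>"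
  shows "(\<forall>F :: nat \<Rightarrow> real^'n \<Rightarrow> real^'m. (\<forall>k. F k \<in> family_F \<phi> M D x0) \<longrightarrow>
            (\<exists>r g. strict_mono r \<and>
               (\<forall>K. compact K \<and> K \<subseteq> D \<longrightarrow> uniform_limit K (F \<circ> r) g sequentially)))
       \<and> (\<forall>(F :: nat \<Rightarrow> real^'n \<Rightarrow> real^'m) g. (\<forall>k. F k \<in> family_F \<phi> M D x0) \<and>
            (\<forall>K. compact K \<and> K \<subseteq> D \<longrightarrow> uniform_limit K F g sequentially)
            \<longrightarrow> g \<in> family_F \<phi> M D x0)"
proof -
  define p where "p = 1 + 1 / \<alpha>"
  obtain A B where AB: "0 \<le> A" "0 \<le> B"
    "\<And>t. 0 \<le> t \<Longrightarrow> ennreal (t powr p) \<le> ennreal A * \<phi> (ennreal t) + ennreal B"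
    using energy_growth[OF phi_mono tstar alpha(1) integral] unfolding p_def by blast
  have "1 < real CARD('n)" using n2 by simp
  \<comment> \<open>The bound on \<alpha> becomes p > n, for the oscillation estimate; with n \<ge>
    2 it also gives p \<ge> 2, for the square norm.\<close>
  then have "real CARD('n) - 1 < 1 / \<alpha>"
    using alpha by (simp add: field_simps)
  then have p: "real CARD('n) < p" by (simp add: p_def)
  with n2 have p2: "2 \<le> p" by linarith
  have \<phi>: "\<phi> \<in> borel_measurable borel"
    using phi_cont by (rule borel_measurable_continuous_onI)
  show ?thesis
  proof (intro conjI allI impI)
    fix F :: "nat \<Rightarrow> real^'n \<Rightarrow> real^'m"
    assume F: "\<forall>k. F k \<in> family_F \<phi> M D x0"
    show "\<exists>r g. strict_mono r \<and> (\<forall>K. compact K \<and> K \<subseteq> D \<longrightarrow> uniform_limit K (F \<circ> r) g sequentially)"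
    proof (rule equicontinuous_imp_locally_uniform_subsequence[OF dom x0])
      show "F k x0 = 0" for k using F by (simp add: family_F_def)
      show "\<exists>d>0. \<forall>k y. norm (a - y) < d \<longrightarrow> norm (F k a - F k y) < e" if "a \<in> D" "0 < e" for a e
      proof (rule family_equicontinuous[OF dom(1) that(1) \<phi> AB p M that(2), where ?x0.0 = x0])
        fix d assume "0 < d" "\<And>f y. (f :: real^'n \<Rightarrow> real^'m) \<in> family_F \<phi> M D x0 \<Longrightarrow> norm (a - y) < d \<Longrightarrow> norm (f a - f y) < e"
        with F show ?thesis by blast
      qed
    qed
  next
    fix F :: "nat \<Rightarrow> real^'n \<Rightarrow> real^'m" and g
    assume "(\<forall>k. F k \<in> family_F \<phi> M D x0) \<and> (\<forall>K. compact K \<and> K \<subseteq> D \<longrightarrow> uniform_limit K F g sequentially)"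
    then show "g \<in> family_F \<phi> M D x0"
      by (intro family_F_closed[OF dom(1) x0 M phi_cont phi_mono phi_convex AB p2, of F g]) auto
  qed
qed

end
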